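(* For each finitely generated abelian group $G$, the group $T(G) = N_{S(G)}(\mathrm{Hol}(G)) / \mathrm{Hol}(G)$ is elementary abelian, of order $1$, $2$, or $4$.
   Context: $S(G)$ is the group of all permutations of the set $G$, $\rho : G \to S(G)$, $\rho(g) : x \mapsto x + g$, is the regular representation, and $\mathrm{Hol}(G) = N_{S(G)}(\rho(G))$. Elementary abelian here means elementary abelian $2$-group (possibly trivial). *)

theory Defs
  imports "HOL-Algebra.Algebra"
begin

text \<open>
  Abelian groups are written multiplicatively, as in \<open>HOL-Algebra\<close>. The permutation
  group \<open>S(G)\<close> is \<^term>\<open>BijGroup (carrier G)\<close>, whose elements are the bijections of
  \<^term>\<open>carrier G\<close> that are \<^const>\<open>undefined\<close> off the carrier; hence the \<^const>\<open>restrict\<close>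
  in the regular representation below.
\<close>

definition finitely_generated_group :: "('a, 'b) monoid_scheme \<Rightarrow> bool"
  where "finitely_generated_group G \<longleftrightarrow>
    group G \<and> (\<exists>S. finite S \<and> S \<subseteq> carrier G \<and> generate G S = carrier G)"

definition regular_rep :: "('a, 'b) monoid_scheme \<Rightarrow> 'a \<Rightarrow> ('a \<Rightarrow> 'a)"
  where "regular_rep G g = (\<lambda>x \<in> carrier G. x \<otimes>\<^bsub>G\<^esub> g)"

definition Hol :: "('a, 'b) monoid_scheme \<Rightarrow> ('a \<Rightarrow> 'a) set"
  where "Hol G = normalizer (BijGroup (carrier G)) (regular_rep G ` carrier G)"

definition NHol :: "('a, 'b) monoid_scheme \<Rightarrow> ('a \<Rightarrow> 'a) set"
  where "NHol G = normalizer (BijGroup (carrier G)) (Hol G)"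

definition T_group :: "('a, 'b) monoid_scheme \<Rightarrow> ('a \<Rightarrow> 'a) set monoid"
  where "T_group G = (BijGroup (carrier G)\<lparr>carrier := NHol G\<rparr>) Mod Hol G"

text \<open>The trivial group counts as an elementary abelian 2-group.\<close>

definition elementary_abelian_2_group :: "('a, 'b) monoid_scheme \<Rightarrow> bool"
  where "elementary_abelian_2_group G \<longleftrightarrow>
    comm_group G \<and> (\<forall>x \<in> carrier G. x \<otimes>\<^bsub>G\<^esub> x = \<one>\<^bsub>G\<^esub>)"

end

theory Submission
  imports Defs
begin

text \<open>
  Write \<open>G\<close> additively. Since \<open>Hol(G)\<close> contains all translations, every class of \<open>T(G)\<close> is represented by
  a permutation \<open>\<theta>\<close> that normalizes \<open>Hol(G)\<close> and fixes \<open>0\<close>. Transport the addition along \<open>\<theta>\<close> to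
  \<open>u \<circ> v = \<theta>(\<theta>\<^sup>-u + \<theta>\<^sup>-v)\<close>, where \<open>\<theta>\<^sup>-\<close> is the inverse of \<open>\<theta>\<close>. The translations of \<open>\<circ>\<close> are conjugates of
  translations, so they lie in \<open>Hol(G)\<close> and are affine maps. Together with commutativity of \<open>\<circ>\<close> this says that
  the deviation \<open>b(u,v) = u \<circ> v - u - v\<close> is symmetric and biadditive, and because \<open>\<theta>\<close> also normalizes
  \<open>Aut(G)\<close>, the product \<open>b\<close> is preserved by every automorphism of \<open>G\<close>. The automorphism \<open>-1\<close> then gives \<open>2b = 0\<close>,
  and the automorphisms \<open>v \<mapsto> v + b(v,u)\<close> together with associativity of \<open>\<circ>\<close> give \<open>b(b(v,w),u) = 0\<close>
  (\<open>deviation_nilpotent\<close>). Two permutations with the same deviation differ by an automorphism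
  (\<open>quotient_in_Hol\<close>), so \<open>T(G)\<close> embeds, as a set, into the set of invariant products.

  The heart of the matter is that on a finitely generated group an invariant product is determined by the
  answers to two questions (\<open>invariant_product_unique\<close>): is \<open>b(u,u) = 0\<close> for all \<open>u\<close>, and does
  \<open>b(u,u) = 0\<close> always force \<open>b(u,v) = 0\<close> for all \<open>v\<close>? Hence \<open>T(G)\<close> has at most four elements. Moreover the
  deviation of the inverse of \<open>\<theta>\<close> is \<open>\<theta>\<^sup>-(b(\<theta>u, \<theta>v))\<close>, for which both questions have the same answers as
  for \<open>b\<close>; so \<open>\<theta>\<close> and its inverse are in the same class, that is, \<open>\<theta>\<^sup>2\<close> lies in \<open>Hol(G)\<close>. A group of exponent
  dividing two with at most four elements is elementary abelian of order \<open>1\<close>, \<open>2\<close> or \<open>4\<close>.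

  To see that two answers suffice, take independent generators \<open>x\<^sub>i\<close> with orders \<open>d\<^sub>i\<close> (zero for infinite order).
  The values \<open>b(x\<^sub>p,x\<^sub>q)\<close> are killed by \<open>2\<close>, so the \<open>l\<close>-th coordinate of such a value is \<open>0\<close> or \<open>d\<^sub>l/2\<close> and
  \<open>b\<close> amounts to a table of truth values \<open>\<beta> p q l\<close>. Invariance under the transvections \<open>x\<^sub>i \<mapsto> x\<^sub>i + c x\<^sub>j\<close>
  constrains this table severely. An entry can be true only if \<open>d\<^sub>l\<close> has the largest 2-adic valuation among the
  finite orders. If only one generator has this property, the only pairs \<open>{p,q}\<close> left are \<open>{a,a}\<close> and \<open>{a,a2}\<close>,
  where \<open>x\<^sub>a\<close> and \<open>x\<^sub>a\<^sub>2\<close> are the two generators whose orders have the largest valuations (\<open>narrow_table\<close>), and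
  the two remaining truth values are what the two questions ask for. If several generators have it, the whole
  table depends on a single truth value (\<open>wide_table_infinite\<close>, \<open>wide_table_finite\<close>), so there is at most one
  nonzero invariant product.
\<close>

section \<open>Independent generators of a finitely generated abelian group\<close>

context comm_group
begin

definition word :: "'i set \<Rightarrow> ('i \<Rightarrow> 'a) \<Rightarrow> ('i \<Rightarrow> int) \<Rightarrow> 'a"
  where "word I x n = (\<Otimes>i\<in>I. x i [^] n i)"

lemma word_closed: "x ` I \<subseteq> carrier G \<Longrightarrow> word I x n \<in> carrier G"
  unfolding word_def by (intro finprod_closed) auto

lemma word_trivial:
  assumes "\<And>i. i \<in> I \<Longrightarrow> x i [^] n i = \<one>"
  shows "word I x n = \<one>"
  unfolding word_def using assms by (rule finprod_one_eqI)

lemma word_add: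
  assumes "x ` I \<subseteq> carrier G"
  shows "word I x (\<lambda>i. n i + m i) = word I x n \<otimes> word I x m"
proof -
  have "word I x (\<lambda>i. n i + m i) = (\<Otimes>i\<in>I. x i [^] n i \<otimes> x i [^] m i)"
    unfolding word_def using assms by (intro finprod_cong') (auto simp: int_pow_mult image_subset_iff)
  also have "\<dots> = word I x n \<otimes> word I x m"
    unfolding word_def using assms by (intro finprod_multf) auto
  finally show ?thesis .
qed

lemma word_minus:
  assumes "x ` I \<subseteq> carrier G"
  shows "word I x (\<lambda>i. - n i) = inv (word I x n)"
proof -
  have "word I x (\<lambda>i. - n i) \<otimes> word I x n = word I x (\<lambda>i. - n i + n i)"
    using word_add[OF assms, of "\<lambda>i. - n i" n] by simp
  also have "\<dots> = \<one>"
    by (intro word_trivial) simp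
  finally show ?thesis
    using word_closed[OF assms] by (intro inv_equality[symmetric]) auto
qed

lemma word_diff:
  assumes "x ` I \<subseteq> carrier G"
  shows "word I x (\<lambda>i. n i - m i) = word I x n \<otimes> inv (word I x m)"
  using word_add[OF assms, of n "\<lambda>i. - m i"] word_minus[OF assms, of m] by simp

lemma word_remove:
  assumes "finite I" "j \<in> I" "x ` I \<subseteq> carrier G"
  shows "word I x n = x j [^] n j \<otimes> word (I - {j}) x n"
proof -
  have "(\<lambda>i. x i [^] n i) \<in> I - {j} \<rightarrow> carrier G" "x j [^] n j \<in> carrier G"
    using assms by auto
  then have "finprod G (\<lambda>i. x i [^] n i) (insert j (I - {j})) = x j [^] n j \<otimes> finprod G (\<lambda>i. x i [^] n i) (I - {j})"
    using assms(1) by (intro finprod_insert) simp_all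
  then show ?thesis
    unfolding word_def insert_Diff[OF assms(2)] .
qed

lemma word_single:
  assumes "finite I" "j \<in> I" "x ` I \<subseteq> carrier G" "\<And>i. i \<in> I \<Longrightarrow> i \<noteq> j \<Longrightarrow> x i [^] n i = \<one>"
  shows "word I x n = x j [^] n j"
proof -
  have "word (I - {j}) x n = \<one>"
    using assms(4) by (intro word_trivial) auto
  then show ?thesis
    using word_remove[OF assms(1-3), of n] assms(2,3) by auto
qed

lemma word_exchange:
  assumes "finite I" "i \<in> I" "j \<in> I" "i \<noteq> j" "x ` I \<subseteq> carrier G"
  shows "word I (x(j := x j \<otimes> x i [^] q)) n = word I x (n(i := n i + q * n j))"
proof -
  let ?y = "x(j := x j \<otimes> x i [^] q)" and ?m = "n(i := n i + q * n j)"
  have xi: "x i \<in> carrier G" and xj: "x j \<in> carrier G"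
    using assms by auto
  have y: "?y ` I \<subseteq> carrier G"
    using assms by auto
  have w: "word (I - {j} - {i}) x n \<in> carrier G"
    using assms(5) by (intro word_closed) auto
  have subset: "?y ` (I - {j}) \<subseteq> carrier G" "x ` (I - {j}) \<subseteq> carrier G"
    using assms(5) by auto
  have fin: "finite (I - {j})" "i \<in> I - {j}"
    using assms by auto
  have rest: "word (I - {j} - {i}) ?y n = word (I - {j} - {i}) x n"
    "word (I - {j} - {i}) x ?m = word (I - {j} - {i}) x n"
    unfolding word_def by (rule finprod_cong'; use assms(5) in auto)+
  have "word I ?y n = (x j \<otimes> x i [^] q) [^] n j \<otimes> (x i [^] n i \<otimes> word (I - {j} - {i}) x n)"
    unfolding word_remove[OF assms(1,3) y] word_remove[OF fin subset(1)] rest using assms(4) by simp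
  also have "(x j \<otimes> x i [^] q) [^] n j = x j [^] n j \<otimes> x i [^] (q * n j)"
    using xi xj by (simp add: int_pow_distrib int_pow_pow)
  also have "x j [^] n j \<otimes> x i [^] (q * n j) \<otimes> (x i [^] n i \<otimes> word (I - {j} - {i}) x n)
      = x j [^] n j \<otimes> (x i [^] (n i + q * n j) \<otimes> word (I - {j} - {i}) x n)"
    using xi xj w by (simp add: int_pow_mult m_ac)
  also have "\<dots> = word I x ?m"
    unfolding word_remove[OF assms(1,3,5)] word_remove[OF fin subset(2)] rest using assms(4) by simp
  finally show ?thesis .
qed

lemma ex_word:
  assumes "finite I" "x ` I \<subseteq> carrier G" "generate G (x ` I) = carrier G" "z \<in> carrier G"
  shows "\<exists>n. z = word I x n"
proof -
  have "z \<in> generate G (x ` I)"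
    using assms by simp
  then show ?thesis
  proof induction
    case one
    have "word I x (\<lambda>_. 0) = \<one>"
      by (intro word_trivial) simp
    then show ?case by (intro exI) (rule sym)
  next
    case (incl h)
    then obtain j where j: "j \<in> I" "h = x j" by auto
    have "word I x (\<lambda>i. if i = j then 1 else 0) = x j"
      using word_single[OF assms(1) j(1) assms(2), of "\<lambda>i. if i = j then 1 else 0"] j assms(2) by auto
    with j have "h = word I x (\<lambda>i. if i = j then 1 else 0)" by simp
    then show ?case by (intro exI)
  next
    case (inv h)
    then obtain j where j: "j \<in> I" "h = x j" by auto
    have "word I x (\<lambda>i. if i = j then - 1 else 0) = inv (x j)"
      using word_single[OF assms(1) j(1) assms(2), of "\<lambda>i. if i = j then - 1 else 0"] j assms(2)
      by (auto simp: int_pow_neg)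
    with j have "inv h = word I x (\<lambda>i. if i = j then - 1 else 0)" by simp
    then show ?case by (intro exI)
  next
    case (eng h1 h2)
    then obtain n m where "h1 = word I x n" "h2 = word I x m" by auto
    then have "h1 \<otimes> h2 = word I x (\<lambda>i. n i + m i)"
      using word_add[OF assms(2)] by simp
    then show ?case by (intro exI)
  qed
qed

lemma generate_exchange:
  assumes "i \<in> I" "j \<in> I" "i \<noteq> j" "x ` I \<subseteq> carrier G" "generate G (x ` I) = carrier G"
  shows "generate G ((x(j := x j \<otimes> x i [^] (q::int))) ` I) = carrier G"
proof -
  let ?y = "x(j := x j \<otimes> x i [^] q)"
  have xi: "x i \<in> carrier G" and xj: "x j \<in> carrier G"
    using assms by auto
  have y: "?y ` I \<subseteq> carrier G"
    using assms by auto
  have sub: "subgroup (generate G (?y ` I)) G"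
    by (rule generate_is_subgroup[OF y])
  have gen: "?y k \<in> generate G (?y ` I)" if "k \<in> I" for k
    using that by (intro generate.incl imageI)
  have yi: "x i \<in> generate G (?y ` I)"
    using gen[OF assms(1)] assms(3) by simp
  have "?y j \<otimes> inv (x i [^] q) \<in> generate G (?y ` I)"
    using subgroup.m_closed[OF sub gen[OF assms(2)]
        subgroup.m_inv_closed[OF sub subgroup_int_pow_closed[OF sub yi]]] .
  moreover have "?y j \<otimes> inv (x i [^] q) = x j"
    using xi xj by (simp add: m_assoc)
  ultimately have yj: "x j \<in> generate G (?y ` I)" by simp
  have "x k \<in> generate G (?y ` I)" if "k \<in> I" for k
    using gen[OF that] yj by (cases "k = j") auto
  then have "generate G (x ` I) \<subseteq> generate G (?y ` I)"
    by (intro generate_subgroup_incl[OF _ sub]) auto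
  then show ?thesis
    using assms(5) generate_incl[OF y] by auto
qed

text \<open>
  The generators indexed by \<open>J\<close> are already independent of each other and of all the rest: each relation is
  trivial in the positions of \<open>J\<close>. The decomposition of \<open>G\<close> is found by enlarging \<open>J\<close> one index at a time.
\<close>

definition partial_basis :: "'i set \<Rightarrow> 'i set \<Rightarrow> ('i \<Rightarrow> 'a) \<Rightarrow> ('i \<Rightarrow> int) \<Rightarrow> bool"
  where "partial_basis I J x d \<longleftrightarrow>
    x ` I \<subseteq> carrier G \<and> generate G (x ` I) = carrier G \<and> (\<forall>j\<in>J. x j [^] d j = \<one>) \<and>
    (\<forall>n. word I x n = \<one> \<longrightarrow> (\<forall>j\<in>J. d j dvd n j))"

lemma partial_basis_exchange:
  assumes "finite I" "partial_basis I J x d" "i \<in> I - J" "j \<in> I - J" "i \<noteq> j"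
  shows "partial_basis I J (x(j := x j \<otimes> x i [^] (q::int))) d"
  unfolding partial_basis_def
proof (intro conjI allI impI ballI)
  have x: "x ` I \<subseteq> carrier G" and gen: "generate G (x ` I) = carrier G"
    using assms(2) unfolding partial_basis_def by auto
  show "(x(j := x j \<otimes> x i [^] q)) ` I \<subseteq> carrier G"
    using x assms by auto
  show "generate G ((x(j := x j \<otimes> x i [^] q)) ` I) = carrier G"
    using assms x gen by (intro generate_exchange) auto
  show "(x(j := x j \<otimes> x i [^] q)) k [^] d k = \<one>" if "k \<in> J" for k
    using that assms unfolding partial_basis_def by auto
  show "d k dvd n k" if "word I (x(j := x j \<otimes> x i [^] q)) n = \<one>" "k \<in> J" for n k
  proof -
    have "word I x (n(i := n i + q * n j)) = \<one>"
      using that(1) word_exchange[of I i j x q n] assms x by auto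
    then have "d k dvd (n(i := n i + q * n j)) k"
      using assms(2) that(2) unfolding partial_basis_def by blast
    then show ?thesis
      using that(2) assms(3) by (auto split: if_splits)
  qed
qed

text \<open>
  The classical argument by a minimal coefficient: among all relations between all generating families obtained
  so far, let \<open>m\<close> be the smallest positive coefficient that occurs outside \<open>J\<close>, say at \<open>j\<close>. Exchanging \<open>x j\<close>
  for \<open>x j \<otimes> x i [^] q\<close> lowers the \<open>i\<close>-th coefficient by \<open>q * m\<close>, so by minimality \<open>m\<close> divides all coefficients
  of that relation and they can be cleared one after the other. What remains is the relation \<open>x j [^] m = \<one>\<close>,
  and a further use of minimality shows that \<open>m\<close> divides the \<open>j\<close>-th coefficient of every relation.
\<close>

lemma partial_basis_step:
  assumes I: "finite I" and x: "partial_basis I J x d"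
    and n: "word I x n = \<one>" "i \<in> I - J" "n i \<noteq> 0"
  obtains y m j where "j \<in> I - J" "partial_basis I (insert j J) y (d(j := m))"
proof -
  define coeff where "coeff m \<longleftrightarrow> m > 0 \<and>
    (\<exists>y n j. partial_basis I J y d \<and> word I y n = \<one> \<and> j \<in> I - J \<and> n j = int m)" for m
  have car: "y ` I \<subseteq> carrier G" if "partial_basis I J y d" for y
    using that unfolding partial_basis_def by blast
  have "coeff (nat \<bar>n i\<bar>)"
  proof (cases "n i > 0")
    case True
    then show ?thesis unfolding coeff_def using x n by auto
  next
    case False
    have "word I x (\<lambda>i. - n i) = \<one>"
      using word_minus[OF car[OF x]] n by simp
    then show ?thesis
      unfolding coeff_def using False n x by (intro conjI exI[of _ x] exI[of _ "\<lambda>i. - n i"] exI[of _ i]) auto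
  qed
  then have m: "coeff (Least coeff)"
    by (rule LeastI)
  define m where "m = Least coeff"
  have m: "coeff m" and least: "\<And>k. coeff k \<Longrightarrow> m \<le> k"
    using m Least_le[of coeff] unfolding m_def by blast+
  have m0: "m > 0" using m unfolding coeff_def by blast
  have zero: "k = 0" if "partial_basis I J y d" "word I y n = \<one>" "j \<in> I - J" "n j = k" "0 \<le> k" "k < int m"
    for y n j k
  proof (rule ccontr)
    assume "k \<noteq> 0"
    then have "coeff (nat k)"
      unfolding coeff_def using that by auto
    then show False using least[of "nat k"] that by linarith
  qed
  have red: "int m dvd n i" if y: "partial_basis I J y d" "word I y n = \<one>" "j \<in> I - J" "n j = int m" "i \<in> I - J"
    for y n j i
  proof (cases "i = j")
    case False
    define q where "q = n i div int m"
    let ?n = "n(i := n i - q * n j)"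
    have n: "?n(i := ?n i + q * ?n j) = n"
      using False by auto
    have "word I (y(j := y j \<otimes> y i [^] q)) ?n = word I y (?n(i := ?n i + q * ?n j))"
      using False I y(3,5) car[OF y(1)] by (intro word_exchange) simp_all
    then have w: "word I (y(j := y j \<otimes> y i [^] q)) ?n = \<one>"
      by (simp only: n y(2))
    have eq: "n i - q * n j = n i mod int m"
      using y q_def by (simp add: minus_div_mult_eq_mod)
    then have "?n i = n i mod int m"
      by simp
    then have "n i mod int m = 0"
      using m0 by (intro zero[OF partial_basis_exchange[OF I y(1,5,3) False, of q] w y(5)]) simp_all
    then show ?thesis by auto
  next
    case True
    then show ?thesis using y(4) by simp
  qed
  obtain y0 n0 j where y0: "partial_basis I J y0 d" "word I y0 n0 = \<one>" "j \<in> I - J" "n0 j = int m"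
    using m unfolding coeff_def by blast
  have "\<exists>y n. partial_basis I J y d \<and> word I y n = \<one> \<and> n j = int m \<and> (\<forall>i\<in>K. n i = 0)"
    if "finite K" "K \<subseteq> I - J - {j}" for K
    using that
  proof (induction K)
    case empty
    then show ?case using y0 by auto
  next
    case (insert i K)
    then obtain y n where y: "partial_basis I J y d" "word I y n = \<one>" "n j = int m" "\<forall>i\<in>K. n i = 0"
      by auto
    have i: "i \<in> I - J" "i \<noteq> j" using insert by auto
    obtain q where q: "n i = q * int m"
      using red[OF y(1,2) y0(3) y(3) i(1)] by (metis dvdE mult.commute)
    let ?n = "n(i := 0)"
    have n: "?n(i := ?n i + q * ?n j) = n"
      using i q y(3) by auto
    have "word I (y(j := y j \<otimes> y i [^] q)) ?n = word I y (?n(i := ?n i + q * ?n j))"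
      using i I y0(3) car[OF y(1)] by (intro word_exchange) simp_all
    then have "word I (y(j := y j \<otimes> y i [^] q)) ?n = \<one>"
      by (simp only: n y(2))
    moreover have "?n j = int m" "\<forall>k\<in>insert i K. ?n k = 0"
      using y(3,4) i(2) by auto
    ultimately show ?case
      using partial_basis_exchange[OF I y(1) i(1) y0(3) i(2), of q] by blast
  qed
  from this[of "I - J - {j}"] obtain y n where
    y: "partial_basis I J y d" "word I y n = \<one>" "n j = int m" "\<forall>i\<in>I - J - {j}. n i = 0"
    using I by auto
  have others: "y i [^] n i = \<one>" if i: "i \<in> I" "i \<noteq> j" for i
    proof (cases "i \<in> J")
      case True
      then obtain k where "n i = d i * k"
        using y(1,2) unfolding partial_basis_def by (meson dvdE)
      then show ?thesis
        using True y(1) i car[OF y(1)] unfolding partial_basis_def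
        by (metis image_subset_iff int_pow_one int_pow_pow)
  next
    case False
    then have "n i = 0" using y(4) i by auto
    then show ?thesis by simp
  qed
  have "j \<in> I" using y0(3) by simp
  then have "word I y n = y j [^] n j"
    using word_single[OF I _ car[OF y(1)] others] by simp
  then have tors: "y j [^] int m = \<one>"
    using y(2,3) by simp
  have "int m dvd k j" if k: "word I y k = \<one>" for k
  proof -
    define q where "q = k j div int m"
    have "word I y (\<lambda>i. if i = j then q * int m else 0) = y j [^] (q * int m)"
      using word_single[OF I _ car[OF y(1)], of j "\<lambda>i. if i = j then q * int m else 0"] y0(3) by auto
    also have "\<dots> = \<one>"
      using tors car[OF y(1)] y0(3)
      by (metis DiffD1 image_subset_iff int_pow_one int_pow_pow mult.commute)
    finally have w: "word I y (\<lambda>i. k i - (if i = j then q * int m else 0)) = \<one>"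
      using word_diff[OF car[OF y(1)]] k by simp
    have "k j - (if j = j then q * int m else 0) = k j mod int m"
      unfolding q_def by (simp add: minus_div_mult_eq_mod)
    then have "k j mod int m = 0"
      using m0 by (intro zero[OF y(1) w y0(3)]) simp_all
    then show ?thesis by auto
  qed
  then have "partial_basis I (insert j J) y (d(j := int m))"
    using y(1) tors y0(3) unfolding partial_basis_def by auto
  then show ?thesis using that y0(3) by blast
qed

lemma ex_basis:
  assumes "finite I" "partial_basis I J x d"
  shows "\<exists>y e. partial_basis I I y e"
  using assms
proof (induction "card (I - J)" arbitrary: J x d rule: less_induct)
  case less
  show ?case
  proof (cases "\<exists>n i. word I x n = \<one> \<and> i \<in> I - J \<and> n i \<noteq> 0")
    case True
    then obtain y m j where j: "j \<in> I - J" "partial_basis I (insert j J) y (d(j := m))"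
      using partial_basis_step[OF less.prems] by metis
    moreover have "I - insert j J = (I - J) - {j}" by auto
    ultimately have "card (I - insert j J) < card (I - J)"
      using less.prems(1) by (metis card_Diff1_less finite_Diff)
    then show ?thesis
      using less.hyps[OF _ less.prems(1) j(2)] by blast
  next
    case False
    let ?e = "\<lambda>i. if i \<in> J then d i else 0"
    have "partial_basis I I x ?e"
      using less.prems False unfolding partial_basis_def by (auto split: if_splits)
    then show ?thesis by blast
  qed
qed

end

text \<open>
  \<open>G\<close> is the internal direct sum of the cyclic groups generated by the \<open>x i\<close>. The case \<open>d i = 0\<close> stands for
  infinite order.
\<close>

locale cyclic_basis = comm_group G for G (structure) +
  fixes I :: "'i set" and x :: "'i \<Rightarrow> 'a" and d :: "'i \<Rightarrow> int"
  assumes finite_I: "finite I"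
    and basis_closed: "x ` I \<subseteq> carrier G"
    and generates: "generate G (x ` I) = carrier G"
    and torsion: "i \<in> I \<Longrightarrow> x i [^] d i = \<one>"
    and independent: "word I x n = \<one> \<Longrightarrow> i \<in> I \<Longrightarrow> d i dvd n i"

lemma (in comm_group) ex_cyclic_basis:
  assumes "finite S" "S \<subseteq> carrier G" "generate G S = carrier G"
  shows "\<exists>(I :: nat set) x d. cyclic_basis G I x d"
proof -
  obtain s :: "nat \<Rightarrow> 'a" and n where s: "S = s ` {..<n}"
    using finite_imp_nat_seg_image_inj_on[OF assms(1)] by (metis lessThan_def)
  then have "partial_basis {..<n} {} s (\<lambda>_. 0)"
    using assms unfolding partial_basis_def by simp
  then obtain x d where "partial_basis {..<n} {..<n} x d"
    using ex_basis[of "{..<n}" "{}" s "\<lambda>_. 0"] by blast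
  then have "cyclic_basis G {..<n} x d"
    unfolding partial_basis_def
    by (intro cyclic_basis.intro cyclic_basis_axioms.intro comm_group_axioms) auto
  then show ?thesis by blast
qed

section \<open>Boolean tables constrained by transvections\<close>

lemma odd_multiple_total:
  fixes a b :: int
  shows "(\<exists>c. odd c \<and> b dvd c * a) \<or> (\<exists>c. odd c \<and> a dvd c * b)"
proof (cases "a = 0 \<or> b = 0")
  case True
  then show ?thesis by (auto intro: exI[of _ 1])
next
  case False
  have split: "\<exists>r u. z = 2 ^ r * u \<and> odd u" if "z \<noteq> 0" for z :: int
    using multiplicity_decompose'[of z 2] that by (metis odd_one)
  obtain r u where a: "a = 2 ^ r * u" "odd u" using split[of a] False by blast
  obtain s w where b: "b = 2 ^ s * w" "odd w" using split[of b] False by blast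
  show ?thesis
  proof (cases "r \<le> s")
    case True
    then have "(2::int) ^ r dvd 2 ^ s" by (rule le_imp_power_dvd)
    then have "a dvd u * b" unfolding a b by (simp add: mult.left_commute mult_dvd_mono)
    then show ?thesis using a(2) by blast
  next
    case False
    then have "(2::int) ^ s dvd 2 ^ r" by (intro le_imp_power_dvd) simp
    then have "b dvd w * a" unfolding a b by (simp add: mult.left_commute mult_dvd_mono)
    then show ?thesis using b(2) by blast
  qed
qed

text \<open>
  With \<open>v\<close> the 2-adic valuation and \<open>v(0) = \<infinity>\<close>, this says \<open>v(d j) \<le> v(d i)\<close>. The form chosen is the one in which it
  is used: an odd multiple of \<open>x j\<close> may be added to \<open>x i\<close> by a homomorphism.
\<close>

definition dominates :: "('i \<Rightarrow> int) \<Rightarrow> 'i \<Rightarrow> 'i \<Rightarrow> bool"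
  where "dominates d i j \<longleftrightarrow> (\<exists>c. odd c \<and> d j dvd c * d i)"

lemma dominatesE:
  assumes "dominates d i j"
  obtains c e where "odd c" "c * d i = d j * e"
proof -
  obtain c where c: "odd c" "d j dvd c * d i"
    using assms unfolding dominates_def by blast
  from c(2) obtain e where "c * d i = d j * e" by (rule dvdE)
  then show ?thesis using that c(1) by blast
qed

lemma dominates_total: "dominates d i j \<or> dominates d j i"
  unfolding dominates_def by (rule odd_multiple_total)

lemma dominates_trans:
  assumes "dominates d i j" "dominates d j k"
  shows "dominates d i k"
proof -
  obtain c c' where c: "odd c" "d j dvd c * d i" "odd c'" "d k dvd c' * d j"
    using assms unfolding dominates_def by blast
  have "d k dvd c' * (c * d i)"
    using c(2,4) by (meson dvd_trans dvd_refl mult_dvd_mono)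
  then have "d k dvd (c' * c) * d i" by (simp add: mult.assoc)
  moreover have "odd (c' * c)" using c by simp
  ultimately show ?thesis unfolding dominates_def by blast
qed

lemma ex_dominating:
  assumes "finite A" "A \<noteq> {}"
  shows "\<exists>a\<in>A. \<forall>j\<in>A. dominates d a j"
  using assms
proof (induction rule: finite_ne_induct)
  case (singleton a)
  then show ?case using dominates_total[of d a a] by blast
next
  case (insert b A)
  then obtain a where a: "a \<in> A" "\<forall>j\<in>A. dominates d a j" by blast
  show ?case
  proof (cases "dominates d a b")
    case False
    then have ba: "dominates d b a" using dominates_total[of d a b] by simp
    have "dominates d b j" if "j \<in> A" for j
      using dominates_trans[OF ba] a(2) that by blast
    then show ?thesis using dominates_total[of d b b] by blast
  qed (use a in blast)
qed

lemma dominates_nonzero: "dominates d i j \<Longrightarrow> d i \<noteq> 0 \<Longrightarrow> d j \<noteq> 0"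
  unfolding dominates_def by auto

text \<open>
  In the application \<open>\<beta> p q l\<close> records whether the \<open>l\<close>-th coordinate of \<open>b (x p) (x q)\<close> is nonzero. The last three
  assumptions express invariance under the transvection \<open>x i \<mapsto> x i \<otimes> x j [^] c\<close>: on arguments it adds row \<open>j\<close>
  to row \<open>i\<close> when \<open>c\<close> is odd, while on values it adds coordinate \<open>i\<close> to coordinate \<open>j\<close> when \<open>e\<close> is odd, because
  it sends \<open>x i [^] (d i / 2)\<close> to its product with \<open>x j [^] (e * (d j / 2))\<close>. Comparing both effects gives \<open>fixed\<close> if neither
  argument is \<open>x i\<close>, \<open>moved\<close> if exactly one is, and \<open>moved_diag\<close> if both are.
\<close>

locale invariant_table =
  fixes I :: "'i set" and d :: "'i \<Rightarrow> int" and \<beta> :: "'i \<Rightarrow> 'i \<Rightarrow> 'i \<Rightarrow> bool"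
  assumes supported: "\<beta> p q l \<Longrightarrow> p \<in> I \<and> q \<in> I \<and> l \<in> I \<and> d l \<noteq> 0"
    and sym: "\<beta> p q l \<longleftrightarrow> \<beta> q p l"
    and fixed: "\<lbrakk>i \<in> I; j \<in> I; i \<noteq> j; c * d i = d j * e; d j \<noteq> 0 \<or> even e; odd e; p \<noteq> i; q \<noteq> i\<rbrakk> \<Longrightarrow>
      \<not> \<beta> p q i"
    and moved: "\<lbrakk>i \<in> I; j \<in> I; i \<noteq> j; c * d i = d j * e; d j \<noteq> 0 \<or> even e; q \<noteq> i\<rbrakk> \<Longrightarrow>
      (odd c \<and> \<beta> j q l) \<longleftrightarrow> (l = j \<and> odd e \<and> \<beta> i q i)"
    and moved_diag: "\<lbrakk>i \<in> I; j \<in> I; i \<noteq> j; c * d i = d j * e; d j \<noteq> 0 \<or> even e\<rbrakk> \<Longrightarrow>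
      (odd c \<and> \<beta> j j l) \<longleftrightarrow> (l = j \<and> odd e \<and> \<beta> i i i)"
begin

text \<open>
  A transvection that adds an odd multiple of \<open>x j\<close> to \<open>x i\<close> leaves the \<open>l\<close>-th coordinate of all values alone, so
  invariance of the entry \<open>(i,q)\<close> forces the summand coming from row \<open>j\<close> to vanish.
\<close>

lemma dominated_vanish:
  assumes ij: "i \<in> I" "j \<in> I" "i \<noteq> j" and M: "dominates d i j" and q: "q \<noteq> i"
    and l: "l \<noteq> j \<or> \<not> dominates d j i \<or> d i = 0"
  shows "\<not> \<beta> j q l"
proof -
  obtain c e where c: "odd c" "c * d i = d j * e"
    using M by (rule dominatesE)
  show ?thesis
  proof (cases "d j = 0")
    case True
    then have "c * d i = d j * 0"
      using c by simp
    from moved[OF ij this _ q, of l] c(1) show ?thesis by simp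
  next
    case False
    have *: "\<beta> j q l \<longleftrightarrow> l = j \<and> odd e \<and> \<beta> i q i"
      using moved[OF ij c(2) _ q, of l] c(1) False by simp
    have "\<not> odd e" if "\<not> dominates d j i"
    proof
      assume "odd e"
      moreover have "d i dvd e * d j"
        by (metis c(2) dvd_triv_right mult.commute)
      ultimately show False using that unfolding dominates_def by blast
    qed
    then show ?thesis using * l supported[of i q i] by blast
  qed
qed

lemma equivalent_coeffs:
  assumes "dominates d i j" "dominates d j i" "d i \<noteq> 0"
  obtains c e where "odd c" "odd e" "c * d i = d j * e" "d j \<noteq> 0"
proof -
  obtain c e where c: "odd c" "c * d i = d j * e"
    using assms(1) by (rule dominatesE)
  obtain c' f where c': "odd c'" "c' * d j = d i * f"
    using assms(2) by (rule dominatesE)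
  have "d i * (f * e) = (c' * d j) * e"
    using c'(2) by simp
  also have "\<dots> = c' * (c * d i)"
    using c(2) by simp
  finally have "f * e = c * c'"
    using assms(3) by simp
  then have "odd (f * e)"
    using c c' by simp
  then have "odd e" by simp
  moreover have "d j \<noteq> 0" using dominates_nonzero[OF assms(1,3)] .
  ultimately show ?thesis using that c by blast
qed

lemma equivalent_rules:
  assumes ij: "i \<in> I" "j \<in> I" "i \<noteq> j" and M: "dominates d i j" "dominates d j i" "d i \<noteq> 0"
  shows "p \<noteq> i \<Longrightarrow> q \<noteq> i \<Longrightarrow> \<not> \<beta> p q i"
    and "q \<noteq> i \<Longrightarrow> \<beta> i q i \<longleftrightarrow> \<beta> j q j"
    and "\<beta> i i i \<longleftrightarrow> \<beta> j j j"
proof -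
  obtain c e where c: "odd c" "odd e" "c * d i = d j * e" "d j \<noteq> 0"
    using equivalent_coeffs[OF M] by blast
  show "\<not> \<beta> p q i" if "p \<noteq> i" "q \<noteq> i"
    using fixed[OF ij c(3) _ c(2) that] c(4) by blast
  show "\<beta> i q i \<longleftrightarrow> \<beta> j q j" if "q \<noteq> i"
    using moved[OF ij c(3) _ that, of j] c by blast
  show "\<beta> i i i \<longleftrightarrow> \<beta> j j j"
    using moved_diag[OF ij c(3), of j] c by blast
qed

text \<open>
  If a finite order \<open>d j\<close> had larger valuation than \<open>d i\<close>, adding a suitable even multiple of \<open>x j\<close> to \<open>x i\<close>
  would change no argument modulo squares but would still move every value with nonzero \<open>i\<close>-th coordinate.
\<close>

lemma value_dominates:
  assumes "\<beta> p q i" "j \<in> I" "d j \<noteq> 0"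
  shows "dominates d i j"
proof (rule ccontr)
  assume not: "\<not> dominates d i j"
  then have "i \<noteq> j" and M: "dominates d j i"
    using dominates_total[of d] by blast+
  have i: "i \<in> I" using assms(1) supported by blast
  obtain c' c where c: "odd c'" "c' * d j = d i * c"
    using M by (rule dominatesE)
  \<comment> \<open>\<open>c\<close> is the even multiplier: an odd one would contradict \<open>not\<close>\<close>
  have eq: "c * d i = d j * c'"
    using c(2) by (simp add: mult.commute)
  have "even c"
    using not eq unfolding dominates_def by (metis dvd_triv_left)
  note rules = fixed[OF i assms(2) \<open>i \<noteq> j\<close> eq] moved[OF i assms(2) \<open>i \<noteq> j\<close> eq] moved_diag[OF i assms(2) \<open>i \<noteq> j\<close> eq]
  have "\<not> \<beta> i r i" if "r \<noteq> i" for r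
    using rules(2)[OF _ that, of j] \<open>even c\<close> c(1) assms(3) by blast
  moreover have "\<not> \<beta> i i i"
    using rules(3)[of j] \<open>even c\<close> c(1) assms(3) by blast
  moreover have "\<not> \<beta> p' q' i" if "p' \<noteq> i" "q' \<noteq> i" for p' q'
    using rules(1)[OF _ c(1) that] assms(3) by blast
  ultimately show False
    using assms(1) sym by metis
qed

end

definition finite_top :: "'i set \<Rightarrow> ('i \<Rightarrow> int) \<Rightarrow> 'i set"
  where "finite_top I d = {l \<in> I. d l \<noteq> 0 \<and> (\<forall>j\<in>I. d j \<noteq> 0 \<longrightarrow> dominates d l j)}"

context invariant_table
begin

lemma value_in_finite_top: "\<beta> p q l \<Longrightarrow> l \<in> finite_top I d"
  unfolding finite_top_def using value_dominates supported by blast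

lemma finite_top_upward:
  assumes "j \<in> finite_top I d" "i \<in> I" "d i \<noteq> 0" "dominates d i j"
  shows "i \<in> finite_top I d"
  using assms unfolding finite_top_def by (auto intro: dominates_trans)

text \<open>
  Domination by \<open>a\<close> kills all entries outside row and column \<open>a\<close>, and domination by \<open>a2\<close> kills what
  is left of row \<open>a\<close> apart from the columns \<open>a\<close> and \<open>a2\<close>. The exceptional case of \<open>dominated_vanish\<close>, two
  equivalent finite orders, would give two elements of \<open>finite_top\<close>.
\<close>

lemma narrow_table:
  assumes narrow: "\<And>l l'. l \<in> finite_top I d \<Longrightarrow> l' \<in> finite_top I d \<Longrightarrow> l = l'"
    and a: "a \<in> I" "\<And>j. j \<in> I \<Longrightarrow> dominates d a j"
    and a2: "a2 \<noteq> a" "\<And>j. j \<in> I \<Longrightarrow> j \<noteq> a \<Longrightarrow> a2 \<in> I \<and> dominates d a2 j"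
    and \<beta>: "\<beta> p q l"
  shows "p = a \<and> q = a \<or> p = a \<and> q = a2 \<or> p = a2 \<and> q = a"
proof -
  have outside: "\<not> \<beta> j q l" if "j \<noteq> a" "q \<noteq> a" for j q l
  proof
    assume *: "\<beta> j q l"
    then have j: "j \<in> I" using supported by blast
    then have l: "l = j" and "d a \<noteq> 0"
      using dominated_vanish[OF a(1) j that(1)[symmetric] a(2)[OF j] that(2), of l] * by blast+
    moreover have top: "j \<in> finite_top I d"
      using value_in_finite_top[OF *] l by simp
    ultimately have "a \<in> finite_top I d"
      using finite_top_upward[OF top a(1) _ a(2)[OF j]] by blast
    then show False using narrow[OF top] that(1) by blast
  qed
  have row: "\<not> \<beta> j a l" if "j \<noteq> a" "j \<noteq> a2" for j l
  proof
    assume *: "\<beta> j a l"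
    then have j: "j \<in> I" using supported by blast
    have a2j: "a2 \<in> I" "dominates d a2 j"
      using a2(2)[OF j that(1)] by blast+
    have l: "l = j" and "d a2 \<noteq> 0"
      using dominated_vanish[OF a2j(1) j that(2)[symmetric] a2j(2) a2(1)[symmetric], of l] * by blast+
    moreover have top: "j \<in> finite_top I d"
      using value_in_finite_top[OF *] l by simp
    ultimately have "a2 \<in> finite_top I d"
      using finite_top_upward[OF top a2j(1) _ a2j(2)] by blast
    then show False using narrow[OF top] that(2) by blast
  qed
  show ?thesis
    using outside[of p q l] row[of p l] row[of q l] \<beta> sym by blast
qed

lemma finite_top_equivalent:
  assumes "i \<in> finite_top I d" "j \<in> finite_top I d" "i \<noteq> j"
  shows "p \<noteq> i \<Longrightarrow> q \<noteq> i \<Longrightarrow> \<not> \<beta> p q i"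
    and "q \<noteq> i \<Longrightarrow> \<beta> i q i \<longleftrightarrow> \<beta> j q j"
    and "\<beta> i i i \<longleftrightarrow> \<beta> j j j"
  using equivalent_rules[of i j] assms unfolding finite_top_def by blast+

text \<open>
  An example with these entries is \<open>\<int> \<oplus> P\<close> with \<open>P\<close> of exponent \<open>2\<^sup>k\<close>, where \<open>b((m,y),(n,z)) = 2\<^bsup>k-1\<^esup>(m z + n y)\<close>.
\<close>

lemma wide_table_infinite:
  assumes wide: "l1 \<in> finite_top I d" "l2 \<in> finite_top I d" "l1 \<noteq> l2"
    and a: "a \<in> I" "\<And>j. j \<in> I \<Longrightarrow> dominates d a j" "d a = 0"
  shows "\<beta> p q l \<longleftrightarrow>
    \<beta> l1 a l1 \<and> l \<in> finite_top I d \<and> (p = a \<and> q = l \<or> p = l \<and> q = a)"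
proof -
  have another: "\<exists>k. k \<in> finite_top I d \<and> k \<noteq> l" for l
    using wide by blast
  have finite: "l \<noteq> a" if "l \<in> finite_top I d" for l
    using that a(3) unfolding finite_top_def by blast
  have outside: "\<not> \<beta> j q l" if "j \<noteq> a" "q \<noteq> a" for j q l
    using dominated_vanish[OF a(1) _ _ a(2), of j q l] that supported[of j q l] a(3) by blast
  have row: "q = l" if *: "\<beta> a q l" for q l
  proof -
    have l: "l \<in> finite_top I d" using value_in_finite_top[OF *] .
    obtain k where "k \<in> finite_top I d" "k \<noteq> l" using another by blast
    then show ?thesis
      using finite_top_equivalent(1)[OF l, of k a q] * finite[OF l] by blast
  qed
  have const: "\<beta> l a l \<longleftrightarrow> \<beta> l1 a l1" if "l \<in> finite_top I d" for l
    using finite_top_equivalent(2)[OF that wide(1), of a] finite[OF that] by blast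
  show ?thesis
  proof
    assume *: "\<beta> p q l"
    note l = value_in_finite_top[OF *]
    have "p = a \<and> q = l \<or> p = l \<and> q = a"
      using outside[of p q l] row[of q l] row[of p l] * sym by blast
    then show "\<beta> l1 a l1 \<and> l \<in> finite_top I d \<and> (p = a \<and> q = l \<or> p = l \<and> q = a)"
      using const[OF l] l * sym by blast
  next
    assume *: "\<beta> l1 a l1 \<and> l \<in> finite_top I d \<and> (p = a \<and> q = l \<or> p = l \<and> q = a)"
    then show "\<beta> p q l" using const[of l] sym by blast
  qed
qed

text \<open>
  The entries are those of \<open>b(x\<^sub>i,x\<^sub>i) = \<omega>\<^sub>i\<close> and \<open>b(x\<^sub>i,x\<^sub>j) = \<omega>\<^sub>i + \<omega>\<^sub>j\<close>, with \<open>\<omega>\<^sub>i\<close> the involution in the span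
  of \<open>x\<^sub>i\<close>. For two generators of equal order \<open>2\<^sup>k\<close> this is the product \<open>(u,v) \<mapsto> (uv)\<^sup>2\<close> of the field with four
  elements, which is preserved by all of \<open>GL\<^sub>2(2)\<close> because that group is generated by the multiplications and
  the Frobenius map.
\<close>

lemma wide_table_finite:
  assumes wide: "l1 \<in> finite_top I d" "l2 \<in> finite_top I d" "l1 \<noteq> l2"
    and a: "a \<in> I" "\<And>j. j \<in> I \<Longrightarrow> dominates d a j" "d a \<noteq> 0"
  shows "\<beta> p q l \<longleftrightarrow>
    \<beta> l1 l1 l1 \<and> p \<in> finite_top I d \<and> q \<in> finite_top I d \<and> l \<in> finite_top I d \<and> (l = p \<or> l = q)"
proof -
  have another: "\<exists>k. k \<in> finite_top I d \<and> k \<noteq> l" for l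
    using wide by blast
  have nonzero: "d j \<noteq> 0" if "j \<in> I" for j
    using dominates_nonzero[OF a(2)[OF that] a(3)] .
  have outside: "j \<in> finite_top I d" if *: "\<beta> j q l" for j q l
  proof (rule ccontr)
    assume not: "j \<notin> finite_top I d"
    obtain i where i: "i \<in> finite_top I d" "i \<noteq> q" using another by blast
    have j: "j \<in> I" using * supported by blast
    have "dominates d i j" "i \<in> I"
      using i(1) nonzero[OF j] j unfolding finite_top_def by blast+
    moreover have "\<not> dominates d j i"
      using finite_top_upward[OF i(1) j nonzero[OF j]] not by blast
    ultimately show False
      using dominated_vanish[of i j q l] i not j * by blast
  qed
  have inside: "l = p \<or> l = q" if *: "\<beta> p q l" for p q l
  proof -
    have l: "l \<in> finite_top I d" using value_in_finite_top[OF *] .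
    obtain k where "k \<in> finite_top I d" "k \<noteq> l" using another by blast
    then show ?thesis
      using finite_top_equivalent(1)[OF l, of k p q] * by blast
  qed
  have const: "\<beta> l l l \<longleftrightarrow> \<beta> l1 l1 l1" if "l \<in> finite_top I d" for l
    using finite_top_equivalent(3)[OF that wide(1)] by blast
  have row: "\<beta> l q l \<longleftrightarrow> \<beta> l1 l1 l1" if "l \<in> finite_top I d" "q \<in> finite_top I d" for l q
  proof (cases "q = l")
    case False
    then show ?thesis
      using finite_top_equivalent(2)[OF that, of q] const[OF that(2)] by blast
  qed (use const that in blast)
  show ?thesis
  proof
    assume *: "\<beta> p q l"
    have p: "p \<in> finite_top I d" "q \<in> finite_top I d"
      using outside[OF *] outside[of q p l] * sym by blast+
    have "\<beta> l1 l1 l1"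
      using inside[OF *] row[OF p] row[OF p(2,1)] * sym by blast
    then show "\<beta> l1 l1 l1 \<and> p \<in> finite_top I d \<and> q \<in> finite_top I d \<and> l \<in> finite_top I d \<and> (l = p \<or> l = q)"
      using p value_in_finite_top[OF *] inside[OF *] by blast
  next
    assume "\<beta> l1 l1 l1 \<and> p \<in> finite_top I d \<and> q \<in> finite_top I d \<and> l \<in> finite_top I d \<and> (l = p \<or> l = q)"
    then show "\<beta> p q l" using row sym by blast
  qed
qed

end

section \<open>Coordinates, transvections and two-torsion\<close>

lemma dvd_cong_diff: "(D::int) dvd a - b \<Longrightarrow> D dvd a \<longleftrightarrow> D dvd b"
  by (metis dvd_add_right_iff dvd_minus_iff diff_add_cancel)

lemma half_dvd:
  fixes a u D :: int
  assumes "D \<noteq> 0" "2 * a = D * u"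
  shows "D dvd a \<longleftrightarrow> even u"
proof
  assume "D dvd a"
  then obtain k where "a = D * k" by (rule dvdE)
  then have "D * u = D * (2 * k)" unfolding assms(2)[symmetric] by simp
  then have "u = 2 * k" using assms(1) by simp
  then show "even u" by simp
next
  assume "even u"
  then obtain k where "u = 2 * k" by (rule evenE)
  then have "2 * a = 2 * (D * k)" using assms(2) by simp
  then have "a = D * k" by simp
  then show "D dvd a" by simp
qed

lemma half_dvd_add:
  fixes a b D :: int
  assumes "D dvd 2 * a" "D dvd 2 * b"
  shows "D dvd a + b \<longleftrightarrow> (D dvd a \<longleftrightarrow> D dvd b)"
proof (cases "D = 0")
  case False
  obtain u where u: "2 * a = D * u" using assms(1) by (rule dvdE)
  obtain v where v: "2 * b = D * v" using assms(2) by (rule dvdE)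
  have "2 * (a + b) = D * (u + v)" using u v by (simp add: algebra_simps)
  from half_dvd[OF False this] half_dvd[OF False u] half_dvd[OF False v] show ?thesis by simp
qed (use assms in auto)

text \<open>
  Multiplication by \<open>c\<close> carries the element \<open>D/2\<close> of \<open>\<int>/D\<close> to \<open>e\<close> times the element \<open>E/2\<close> of \<open>\<int>/E\<close>.
\<close>

lemma half_dvd_scale:
  fixes a c e D E :: int
  assumes "D dvd 2 * a" "c * D = E * e" "E \<noteq> 0 \<or> even e"
  shows "E dvd c * a \<longleftrightarrow> D dvd a \<or> even e"
proof -
  obtain u where u: "2 * a = D * u" using assms(1) by (rule dvdE)
  show ?thesis
  proof (cases "D = 0 \<or> E = 0")
    case True
    then have "a = 0 \<or> c = 0" "D = 0 \<longrightarrow> a = 0" using u assms(2) by auto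
    then show ?thesis using True assms(3) by auto
  next
    case False
    have "2 * (c * a) = c * (D * u)" using u by simp
    also have "\<dots> = E * (e * u)" using assms(2) by (metis mult.assoc)
    finally have "E dvd c * a \<longleftrightarrow> even (e * u)" using half_dvd[of E "c * a"] False by simp
    moreover have "D dvd a \<longleftrightarrow> even u" using half_dvd[OF _ u] False by simp
    ultimately show ?thesis by auto
  qed
qed

lemma (in group) involution_int_pow:
  assumes "z \<in> carrier G" "z \<otimes> z = \<one>"
  shows "z [^] (c::int) = (if odd c then z else \<one>)"
proof -
  have "z [^] (2::int) = \<one>"
    using int_pow_mult[of z 1 1] assms by simp
  then have even: "z [^] (2 * k) = \<one>" for k :: int
    using int_pow_pow[of z 2 k] assms(1) by simp
  show ?thesis
  proof (cases "odd c")
    case True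
    then obtain k where "c = 2 * k + 1" by (rule oddE)
    then show ?thesis using True int_pow_mult[of z "2 * k" 1] even assms(1) by simp
  next
    case False
    then obtain k where "c = 2 * k" by (auto elim: evenE)
    then show ?thesis using False even by simp
  qed
qed

context cyclic_basis
begin

text \<open>
  Because of the arbitrary choice, coordinates are meaningful only modulo \<open>d i\<close>, and all statements about them
  are congruences.
\<close>

definition coord :: "'i \<Rightarrow> 'a \<Rightarrow> int"
  where "coord i z = (SOME n. z = word I x n) i"

lemma x_closed: "i \<in> I \<Longrightarrow> x i \<in> carrier G"
  using basis_closed by blast

lemma word_coord: "z \<in> carrier G \<Longrightarrow> word I x (\<lambda>i. coord i z) = z"
  unfolding coord_def
  using someI_ex[OF ex_word[OF finite_I basis_closed generates]] by simp

lemma coord_word: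
  assumes "z = word I x n" "i \<in> I"
  shows "d i dvd coord i z - n i"
proof -
  have z: "z \<in> carrier G" using assms(1) word_closed[OF basis_closed] by simp
  have "word I x (\<lambda>i. coord i z - n i) = z \<otimes> inv z"
    using word_diff[OF basis_closed, of "\<lambda>i. coord i z" n] word_coord[OF z] assms(1) by simp
  then have "word I x (\<lambda>i. coord i z - n i) = \<one>" using z by simp
  then show ?thesis using independent assms(2) by blast
qed

lemma coord_eq_one:
  assumes "z \<in> carrier G" "\<And>i. i \<in> I \<Longrightarrow> d i dvd coord i z"
  shows "z = \<one>"
proof -
  have "x i [^] coord i z = \<one>" if i: "i \<in> I" for i
  proof -
    obtain k where k: "coord i z = d i * k" using assms(2)[OF i] by (rule dvdE)
    show ?thesis unfolding k using int_pow_pow[OF x_closed[OF i], of "d i" k] torsion[OF i] by simp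
  qed
  then have "word I x (\<lambda>i. coord i z) = \<one>" by (rule word_trivial)
  then show ?thesis using word_coord[OF assms(1)] by simp
qed

lemma coord_mult:
  assumes "z \<in> carrier G" "w \<in> carrier G" "i \<in> I"
  shows "d i dvd coord i (z \<otimes> w) - (coord i z + coord i w)"
proof -
  have "z \<otimes> w = word I x (\<lambda>i. coord i z + coord i w)"
    using word_add[OF basis_closed, of "\<lambda>i. coord i z" "\<lambda>i. coord i w"] word_coord assms by simp
  then show ?thesis using assms(3) by (rule coord_word)
qed

lemma coord_basis_pow:
  assumes "i \<in> I" "j \<in> I"
  shows "d i dvd coord i (x j [^] (n::int)) - (if i = j then n else 0)"
proof -
  have "x j [^] n = word I x (\<lambda>i. if i = j then n else 0)"
    using word_single[OF finite_I assms(2) basis_closed, of "\<lambda>i. if i = j then n else 0"] by simp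
  then show ?thesis using assms(1) by (rule coord_word)
qed

lemma basis_pow_cong:
  assumes "j \<in> I" "d j dvd n - m"
  shows "x j [^] n = x j [^] m"
proof -
  obtain k where k: "n - m = d j * k" using assms(2) by (rule dvdE)
  have "x j [^] (n - m) = \<one>"
    unfolding k using int_pow_pow[OF x_closed[OF assms(1)], of "d j" k] torsion[OF assms(1)] by simp
  then have "x j [^] (n - m + m) = x j [^] m"
    using x_closed[OF assms(1)] by (subst int_pow_mult) auto
  then show ?thesis by simp
qed

definition transvection :: "'i \<Rightarrow> 'i \<Rightarrow> int \<Rightarrow> 'a \<Rightarrow> 'a"
  where "transvection i j c z = z \<otimes> x j [^] (c * coord i z)"

lemma transvection_closed: "j \<in> I \<Longrightarrow> z \<in> carrier G \<Longrightarrow> transvection i j c z \<in> carrier G"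
  unfolding transvection_def using x_closed by simp

lemma coord_transvection:
  assumes "l \<in> I" "j \<in> I" "z \<in> carrier G"
  shows "d l dvd coord l (transvection i j c z) - (coord l z + (if l = j then c * coord i z else 0))"
proof -
  let ?p = "x j [^] (c * coord i z)"
  have "d l dvd coord l (z \<otimes> ?p) - (coord l z + coord l ?p)"
    using assms x_closed by (intro coord_mult) simp_all
  from dvd_add[OF this coord_basis_pow[OF assms(1,2), of "c * coord i z"]]
  show ?thesis unfolding transvection_def by (simp add: algebra_simps)
qed

context
  fixes i j c
  assumes ij: "i \<in> I" "j \<in> I" "i \<noteq> j" and compatible: "d j dvd c * d i"
begin

lemma transvection_cong:
  assumes "d i dvd n - m"
  shows "x j [^] (c * n) = x j [^] (c * m)"
proof (rule basis_pow_cong[OF ij(2)])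
  have "c * d i dvd c * (n - m)" using assms by (rule mult_dvd_mono[OF dvd_refl])
  then show "d j dvd c * n - c * m"
    using compatible dvd_trans by (metis right_diff_distrib)
qed

lemma transvection_mult:
  assumes "z \<in> carrier G" "w \<in> carrier G"
  shows "transvection i j c (z \<otimes> w) = transvection i j c z \<otimes> transvection i j c w"
proof -
  have "x j [^] (c * coord i (z \<otimes> w)) = x j [^] (c * (coord i z + coord i w))"
    by (rule transvection_cong[OF coord_mult[OF assms ij(1)]])
  also have "\<dots> = x j [^] (c * coord i z) \<otimes> x j [^] (c * coord i w)"
    using x_closed[OF ij(2)] by (simp add: distrib_left int_pow_mult)
  finally show ?thesis
    unfolding transvection_def using assms x_closed[OF ij(2)] by (simp add: m_ac)
qed

lemma transvection_basis:
  assumes "q \<in> I"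
  shows "transvection i j c (x q) = (if q = i then x i \<otimes> x j [^] c else x q)"
proof -
  have "d i dvd coord i (x q) - (if i = q then 1 else 0)"
    using coord_basis_pow[OF ij(1) assms, of 1] x_closed[OF assms] by simp
  from transvection_cong[OF this] show ?thesis
    unfolding transvection_def using x_closed[OF assms] by auto
qed

lemma transvection_neg: 
  assumes z: "z \<in> carrier G"
  shows "transvection i j (- c) (transvection i j c z) = z"
proof -
  let ?w = "transvection i j c z"
  have "d i dvd coord i ?w - coord i z"
    using coord_transvection[OF ij(1,2) z, of i c] ij(3) by simp
  from transvection_cong[OF this]
  have "x j [^] (c * coord i ?w) = x j [^] (c * coord i z)" .
  then have "x j [^] (- c * coord i ?w) = inv (x j [^] (c * coord i z))"
    using int_pow_neg[OF x_closed[OF ij(2)], of "c * coord i ?w"] by simp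
  then have "transvection i j (- c) ?w = ?w \<otimes> inv (x j [^] (c * coord i z))"
    unfolding transvection_def[of i j "- c"] by simp
  then show ?thesis
    unfolding transvection_def using z x_closed[OF ij(2)] by (simp add: m_assoc)
qed

end

lemma transvection_iso:
  assumes "i \<in> I" "j \<in> I" "i \<noteq> j" "d j dvd c * d i"
  shows "transvection i j c \<in> iso G G"
proof (rule isoI)
  show "transvection i j c \<in> hom G G"
    using assms transvection_mult transvection_closed by (intro homI) auto
  have neg: "d j dvd - c * d i" using assms(4) by simp
  show "bij_betw (transvection i j c) (carrier G) (carrier G)"
    by (rule bij_betw_byWitness[where f' = "transvection i j (- c)"])
      (use transvection_neg[OF assms] transvection_neg[OF assms(1-3) neg] transvection_closed[OF assms(2)] in auto)
qed

lemma involution_coord: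
  assumes "z \<in> carrier G" "z \<otimes> z = \<one>" "l \<in> I"
  shows "d l dvd 2 * coord l z"
proof -
  have "\<one> = word I x (\<lambda>_. 0)" by (rule word_trivial[symmetric]) simp
  from coord_word[OF this assms(3)] have "d l dvd coord l \<one>" by simp
  then have "d l dvd coord l \<one> - (coord l (z \<otimes> z) - (coord l z + coord l z))"
    using coord_mult[OF assms(1,1,3)] by (rule dvd_diff)
  then show ?thesis using assms(2) by simp
qed

text \<open>
  For \<open>z\<close> with \<open>z \<otimes> z = \<one>\<close> the \<open>l\<close>-th coordinate is \<open>0\<close> or \<open>d l / 2\<close> modulo \<open>d l\<close>, so the marks determine \<open>z\<close>, and on
  such elements they are additive modulo \<open>2\<close>.
\<close>

definition mark :: "'i \<Rightarrow> 'a \<Rightarrow> bool"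
  where "mark l z \<longleftrightarrow> \<not> d l dvd coord l z"

lemma mark_mult:
  assumes "z \<in> carrier G" "z \<otimes> z = \<one>" "w \<in> carrier G" "w \<otimes> w = \<one>" "l \<in> I"
  shows "mark l (z \<otimes> w) \<longleftrightarrow> mark l z \<noteq> mark l w"
  using dvd_cong_diff[OF coord_mult[OF assms(1,3,5)]]
    half_dvd_add[OF involution_coord[OF assms(1,2,5)] involution_coord[OF assms(3,4,5)]]
  unfolding mark_def by blast

lemma mark_transvection:
  assumes "z \<in> carrier G" "z \<otimes> z = \<one>" "i \<in> I" "j \<in> I" "l \<in> I"
    and "c * d i = d j * e" "d j \<noteq> 0 \<or> even e"
  shows "mark l (transvection i j c z) \<longleftrightarrow> mark l z \<noteq> (l = j \<and> odd e \<and> mark i z)"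
proof (cases "l = j")
  case True
  have scale: "d j dvd c * coord i z \<longleftrightarrow> d i dvd coord i z \<or> even e"
    by (rule half_dvd_scale[OF involution_coord[OF assms(1-3)] assms(6,7)])
  have "d j dvd 2 * (c * coord i z)"
  proof -
    have "c * d i dvd c * (2 * coord i z)"
      by (rule mult_dvd_mono[OF dvd_refl involution_coord[OF assms(1-3)]])
    moreover have "d j dvd c * d i" using assms(6) by simp
    ultimately show ?thesis using dvd_trans by (metis mult.left_commute)
  qed
  from half_dvd_add[OF involution_coord[OF assms(1,2,4)] this]
    dvd_cong_diff[OF coord_transvection[OF assms(4,4,1), of i c]] scale True
  show ?thesis unfolding mark_def by auto
next
  case False
  then show ?thesis
    using dvd_cong_diff[OF coord_transvection[OF assms(5,4,1), of i c]] unfolding mark_def by simp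
qed

lemma mark_nonzero_order:
  assumes "z \<in> carrier G" "z \<otimes> z = \<one>" "l \<in> I" "mark l z"
  shows "d l \<noteq> 0"
  using involution_coord[OF assms(1-3)] assms(4) unfolding mark_def by auto

lemma eq_one_if_no_mark:
  assumes "z \<in> carrier G" "\<And>l. l \<in> I \<Longrightarrow> \<not> mark l z"
  shows "z = \<one>"
  using coord_eq_one assms unfolding mark_def by blast

end

section \<open>Products invariant under all automorphisms\<close>

lemma (in group) homs_agree_on_generators:
  assumes "f \<in> hom G G" "h \<in> hom G G" "S \<subseteq> carrier G" "generate G S = carrier G"
    and "\<And>s. s \<in> S \<Longrightarrow> f s = h s" and "z \<in> carrier G"
  shows "f z = h z"
proof -
  interpret f: group_hom G G f by unfold_locales (rule assms)
  interpret h: group_hom G G h by unfold_locales (rule assms)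
  have "z \<in> generate G S" using assms by simp
  then show ?thesis
  proof induction
    case (inv s)
    then show ?case using assms(3,5) by auto
  next
    case (eng u v)
    then have "u \<in> carrier G" "v \<in> carrier G" using assms(4) by auto
    then show ?case using eng by simp
  qed (use assms in auto)
qed

locale invariant_product = comm_group G for G (structure) +
  fixes b :: "'a \<Rightarrow> 'a \<Rightarrow> 'a"
  assumes closed: "u \<in> carrier G \<Longrightarrow> v \<in> carrier G \<Longrightarrow> b u v \<in> carrier G"
    and commute: "u \<in> carrier G \<Longrightarrow> v \<in> carrier G \<Longrightarrow> b u v = b v u"
    and mult_left: "u \<in> carrier G \<Longrightarrow> v \<in> carrier G \<Longrightarrow> w \<in> carrier G \<Longrightarrow> b (u \<otimes> v) w = b u w \<otimes> b v w"
    and invariant: "\<phi> \<in> iso G G \<Longrightarrow> u \<in> carrier G \<Longrightarrow> v \<in> carrier G \<Longrightarrow> \<phi> (b u v) = b (\<phi> u) (\<phi> v)"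
begin

lemma hom_left: "v \<in> carrier G \<Longrightarrow> (\<lambda>u. b u v) \<in> hom G G"
  using closed mult_left by (intro homI) auto

lemma mult_right: "u \<in> carrier G \<Longrightarrow> v \<in> carrier G \<Longrightarrow> w \<in> carrier G \<Longrightarrow> b u (v \<otimes> w) = b u v \<otimes> b u w"
  using commute mult_left by simp

lemma hom_right: "u \<in> carrier G \<Longrightarrow> b u \<in> hom G G"
  using closed mult_right by (intro homI) auto

lemma one_left: "v \<in> carrier G \<Longrightarrow> b \<one> v = \<one>"
  using hom_one[OF hom_left] is_group by blast

lemma inv_left: "u \<in> carrier G \<Longrightarrow> v \<in> carrier G \<Longrightarrow> b (inv u) v = inv (b u v)"
  using group_hom.hom_inv[of G G "\<lambda>u. b u v" u] hom_left
  by (simp add: group_hom_def group_hom_axioms_def is_group)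

lemma inv_iso: "(\<lambda>z. inv z) \<in> iso G G"
proof (rule isoI)
  show "(\<lambda>z. inv z) \<in> hom G G" by (intro homI) (auto simp: inv_mult)
  show "bij_betw (\<lambda>z. inv z) (carrier G) (carrier G)"
    by (rule bij_betw_byWitness[where f' = "\<lambda>z. inv z"]) auto
qed

text \<open>
  The automorphism \<open>inv\<close> inverts the value of \<open>b\<close>, whereas inverting both arguments does not change it.
\<close>

lemma involution:
  assumes "u \<in> carrier G" "v \<in> carrier G"
  shows "b u v \<otimes> b u v = \<one>"
proof -
  have "inv (b u v) = b (inv u) (inv v)"
    using invariant[OF inv_iso assms] .
  also have "\<dots> = inv (inv (b u v))"
    using assms closed inv_left commute[of u "inv v"] inv_left[of v u] commute[of v u] by simp
  finally have "inv (b u v) = b u v" using assms closed by simp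
  then show ?thesis using r_inv[OF closed[OF assms]] by simp
qed

lemma int_pow_left:
  assumes "u \<in> carrier G" "v \<in> carrier G"
  shows "b (u [^] (c::int)) v = (if odd c then b u v else \<one>)"
proof -
  interpret h: group_hom G G "\<lambda>u. b u v"
    by unfold_locales (rule hom_left[OF assms(2)])
  show ?thesis
    using h.hom_int_pow[OF assms(1), of c] involution_int_pow[OF closed[OF assms] involution[OF assms]] by simp
qed

text \<open>
  The two mixed terms are equal and cancel, as values of \<open>b\<close> are involutions.
\<close>

lemma diagonal_hom: "(\<lambda>u. b u u) \<in> hom G G"
proof (rule homI)
  fix u v assume uv: "u \<in> carrier G" "v \<in> carrier G"
  note c = closed[OF uv(1,1)] closed[OF uv] closed[OF uv(2,2)]
  have "b (u \<otimes> v) (u \<otimes> v) = b u u \<otimes> (b u v \<otimes> b u v) \<otimes> b v v"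
    using uv c commute[OF uv] by (simp add: mult_left mult_right m_assoc)
  then show "b (u \<otimes> v) (u \<otimes> v) = b u u \<otimes> b v v"
    using involution[OF uv] c by simp
qed (rule closed)

definition alternating :: bool
  where "alternating \<longleftrightarrow> (\<forall>u\<in>carrier G. b u u = \<one>)"

definition diagonal_detects :: bool
  where "diagonal_detects \<longleftrightarrow> (\<forall>u\<in>carrier G. \<forall>v\<in>carrier G. b u u = \<one> \<longrightarrow> b u v = \<one>)"

lemma trivial_iff:
  "(\<forall>u\<in>carrier G. \<forall>v\<in>carrier G. b u v = \<one>) \<longleftrightarrow> alternating \<and> diagonal_detects"
  unfolding alternating_def diagonal_detects_def by blast

end

locale cyclic_basis_product = cyclic_basis G I x d + invariant_product G b
  for G (structure) and I :: "'i set" and x d b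
begin

definition table :: "'i \<Rightarrow> 'i \<Rightarrow> 'i \<Rightarrow> bool"
  where "table p q l \<longleftrightarrow> p \<in> I \<and> q \<in> I \<and> l \<in> I \<and> mark l (b (x p) (x q))"

lemma basis_value:
  assumes "p \<in> I" "q \<in> I"
  shows "b (x p) (x q) \<in> carrier G" "b (x p) (x q) \<otimes> b (x p) (x q) = \<one>"
  using closed involution x_closed assms by auto

lemma value_eq_one: "p \<in> I \<Longrightarrow> q \<in> I \<Longrightarrow> b (x p) (x q) = \<one> \<longleftrightarrow> (\<forall>l. \<not> table p q l)"
proof
  assume pq: "p \<in> I" "q \<in> I" and "\<forall>l. \<not> table p q l"
  then show "b (x p) (x q) = \<one>"
    using eq_one_if_no_mark[OF basis_value(1)[OF pq]] unfolding table_def by blast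
next
  assume "p \<in> I" "q \<in> I" "b (x p) (x q) = \<one>"
  moreover have "\<not> mark l \<one>" if "l \<in> I" for l
    using mark_mult[of \<one> \<one> l] that by simp
  ultimately show "\<forall>l. \<not> table p q l" unfolding table_def by simp
qed

context
  fixes i j c e
  assumes ij: "i \<in> I" "j \<in> I" "i \<noteq> j" and ce: "c * d i = d j * e" "d j \<noteq> 0 \<or> even e"
begin

lemma transvection_invariant:
  assumes "p \<in> I" "q \<in> I"
  shows "transvection i j c (b (x p) (x q)) = b (transvection i j c (x p)) (transvection i j c (x q))"
  using ce(1) assms x_closed by (intro invariant transvection_iso ij) auto

lemma transvection_of_basis:
  assumes "q \<in> I"
  shows "transvection i j c (x q) = (if q = i then x i \<otimes> x j [^] c else x q)"
  using ce(1) by (intro transvection_basis ij assms) simp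

lemma mark_transvection_value:
  assumes "p \<in> I" "q \<in> I" "l \<in> I"
  shows "mark l (transvection i j c (b (x p) (x q))) \<longleftrightarrow> table p q l \<noteq> (l = j \<and> odd e \<and> table p q i)"
  using mark_transvection[OF basis_value[OF assms(1,2)] ij(1,2) assms(3) ce] assms ij unfolding table_def by simp

lemma table_fixed:
  assumes "odd e" "p \<noteq> i" "q \<noteq> i"
  shows "\<not> table p q i"
proof
  assume *: "table p q i"
  then have pq: "p \<in> I" "q \<in> I" unfolding table_def by auto
  then have "mark j (b (x p) (x q)) \<longleftrightarrow> table p q j \<noteq> (j = j \<and> odd e \<and> table p q i)"
    using mark_transvection_value[OF pq ij(2)] transvection_invariant[OF pq] transvection_of_basis assms by simp
  then show False using * pq ij(2) assms(1) unfolding table_def by blast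
qed

lemma table_moved:
  assumes "q \<noteq> i"
  shows "(odd c \<and> table j q l) \<longleftrightarrow> (l = j \<and> odd e \<and> table i q i)"
proof (cases "q \<in> I \<and> l \<in> I")
  case True
  then have q: "q \<in> I" and l: "l \<in> I" by auto
  have "transvection i j c (b (x i) (x q)) = b (x i \<otimes> x j [^] c) (x q)"
    using transvection_invariant[OF ij(1) q] transvection_of_basis ij(1) q assms by simp
  also have "\<dots> = b (x i) (x q) \<otimes> (if odd c then b (x j) (x q) else \<one>)"
    using x_closed ij q by (simp add: mult_left int_pow_left)
  finally have "mark l (transvection i j c (b (x i) (x q))) \<longleftrightarrow> table i q l \<noteq> (odd c \<and> table j q l)"
    using mark_mult[OF basis_value[OF ij(1) q] basis_value[OF ij(2) q] l] basis_value[OF ij(1) q] q l ij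
    unfolding table_def by simp
  then show ?thesis using mark_transvection_value[OF ij(1) q l] by blast
next
  case False
  then show ?thesis using ij unfolding table_def by blast
qed

lemma table_moved_diag: "(odd c \<and> table j j l) \<longleftrightarrow> (l = j \<and> odd e \<and> table i i i)"
proof (cases "l \<in> I")
  case l: True
  have xi: "x i \<in> carrier G" and xj: "x j [^] c \<in> carrier G" using x_closed ij by auto
  interpret diag: group_hom G G "\<lambda>u. b u u"
    by unfold_locales (rule diagonal_hom)
  have "transvection i j c (b (x i) (x i)) = b (x i \<otimes> x j [^] c) (x i \<otimes> x j [^] c)"
    using transvection_invariant[OF ij(1,1)] transvection_of_basis ij(1) by simp
  also have "\<dots> = b (x i) (x i) \<otimes> b (x j) (x j) [^] c"
    using diag.hom_mult[OF xi xj] diag.hom_int_pow[OF x_closed[OF ij(2)], of c] by simp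
  also have "\<dots> = b (x i) (x i) \<otimes> (if odd c then b (x j) (x j) else \<one>)"
    using involution_int_pow[OF basis_value[OF ij(2,2)]] by simp
  finally have "mark l (transvection i j c (b (x i) (x i))) \<longleftrightarrow> table i i l \<noteq> (odd c \<and> table j j l)"
    using mark_mult[OF basis_value[OF ij(1,1)] basis_value[OF ij(2,2)] l] basis_value[OF ij(1,1)] l ij
    unfolding table_def by simp
  then show ?thesis using mark_transvection_value[OF ij(1,1) l] by blast
next
  case False
  then show ?thesis using ij unfolding table_def by blast
qed

end

sublocale invariant_table I d table
proof
  show "p \<in> I \<and> q \<in> I \<and> l \<in> I \<and> d l \<noteq> 0" if "table p q l" for p q l
    using that mark_nonzero_order basis_value unfolding table_def by blast
  show "table p q l \<longleftrightarrow> table q p l" for p q l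
    unfolding table_def using commute x_closed by auto
qed (rule table_fixed table_moved table_moved_diag; assumption)+

lemma alternating_iff: "alternating \<longleftrightarrow> (\<forall>p l. \<not> table p p l)"
proof
  assume "alternating"
  then have "b (x p) (x p) = \<one>" if "p \<in> I" for p
    using that x_closed unfolding alternating_def by blast
  then show "\<forall>p l. \<not> table p p l" using value_eq_one supported by blast
next
  assume none: "\<forall>p l. \<not> table p p l"
  have triv: "(\<lambda>u. \<one>) \<in> hom G G" by (intro homI) auto
  have "b u u = \<one>" if "u \<in> carrier G" for u
    using homs_agree_on_generators[OF diagonal_hom triv basis_closed generates _ that] value_eq_one none by auto
  then show alternating unfolding alternating_def by blast
qed

text \<open>
  If only the entry \<open>(a,a)\<close> is left, then \<open>b u (x a) = b u u\<close> for all \<open>u\<close>, since both sides are homomorphisms with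
  the same values on the basis. If the entry \<open>(a,a2)\<close> is present, \<open>x a2\<close> is a counterexample.
\<close>

lemma diagonal_detects_iff:
  assumes entries: "\<And>p q l. table p q l \<Longrightarrow> p = a \<and> q = a \<or> p = a \<and> q = a2 \<or> p = a2 \<and> q = a"
    and "a2 \<noteq> a"
  shows "diagonal_detects \<longleftrightarrow> (\<forall>l. \<not> table a a2 l)"
proof
  assume det: diagonal_detects
  show "\<forall>l. \<not> table a a2 l"
  proof (intro allI notI)
    fix l assume *: "table a a2 l"
    then have I: "a \<in> I" "a2 \<in> I" using supported by blast+
    then have "b (x a2) (x a2) = \<one>" using value_eq_one entries assms(2) by blast
    then have "b (x a2) (x a) = \<one>" using det I x_closed unfolding diagonal_detects_def by blast
    then show False using * I value_eq_one sym by blast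
  qed
next
  assume none: "\<forall>l. \<not> table a a2 l"
  have entries: "p = a \<and> q = a" if "table p q l" for p q l
    using entries[OF that] none that sym by blast
  have triv: "(\<lambda>u. \<one>) \<in> hom G G" by (intro homI) auto
  have other: "b u (x j) = \<one>" if u: "u \<in> carrier G" and j: "j \<in> I" "j \<noteq> a" for u j
  proof -
    have "b (x p) (x j) = \<one>" if "p \<in> I" for p
      using value_eq_one[OF that j(1)] entries j(2) by blast
    then show ?thesis
      using homs_agree_on_generators[OF hom_left[OF x_closed[OF j(1)]] triv basis_closed generates _ u] by auto
  qed
  have main: "b u (x a) = b u u" if u: "u \<in> carrier G" and a: "a \<in> I" for u
  proof -
    have "b (x p) (x a) = b (x p) (x p)" if p: "p \<in> I" for p
    proof (cases "p = a")
      case False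
      then have "b (x p) (x a) = \<one>" "b (x p) (x p) = \<one>"
        using value_eq_one[OF p a] value_eq_one[OF p p] entries by blast+
      then show ?thesis by simp
    qed simp
    then show ?thesis
      using homs_agree_on_generators[OF hom_left[OF x_closed[OF a]] diagonal_hom basis_closed generates _ u] by auto
  qed
  show diagonal_detects
    unfolding diagonal_detects_def
  proof (intro ballI impI)
    fix u v assume u: "u \<in> carrier G" and v: "v \<in> carrier G" and diag: "b u u = \<one>"
    have "b u (x j) = \<one>" if "j \<in> I" for j
      using other[OF u that] main[OF u] diag that by (cases "j = a") auto
    then show "b u v = \<one>"
      using homs_agree_on_generators[OF hom_right[OF u] triv basis_closed generates _ v] by auto
  qed
qed

lemma trivial_if_table_empty:
  assumes "\<And>p q l. \<not> table p q l" and u: "u \<in> carrier G" and v: "v \<in> carrier G"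
  shows "b u v = \<one>"
proof -
  have triv: "(\<lambda>u. \<one>) \<in> hom G G" by (intro homI) auto
  have "b u (x q) = \<one>" if q: "q \<in> I" for q
  proof -
    have "b (x p) (x q) = \<one>" if "p \<in> I" for p
      using value_eq_one[OF that q] assms(1) by blast
    then show ?thesis
      using homs_agree_on_generators[OF hom_left[OF x_closed[OF q]] triv basis_closed generates _ u] by auto
  qed
  then show ?thesis
    using homs_agree_on_generators[OF hom_right[OF u] triv basis_closed generates _ v] by auto
qed

end

lemma product_determined_by_table:
  assumes "cyclic_basis_product G I x d b" "cyclic_basis_product G I x d b'"
    and tables: "\<And>p q l. cyclic_basis_product.table G I x d b p q l \<longleftrightarrow> cyclic_basis_product.table G I x d b' p q l"
    and u: "u \<in> carrier G" and v: "v \<in> carrier G"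
  shows "b u v = b' u v"
proof -
  interpret P: cyclic_basis_product G I x d b by (rule assms(1))
  interpret P': cyclic_basis_product G I x d b' by (rule assms(2))
  have basis: "b (x p) (x q) = b' (x p) (x q)" if pq: "p \<in> I" "q \<in> I" for p q
  proof -
    note b = P.basis_value[OF pq] and b' = P'.basis_value[OF pq]
    have "\<not> P.mark l (b (x p) (x q) \<otimes>\<^bsub>G\<^esub> b' (x p) (x q))" if "l \<in> I" for l
      using P.mark_mult[OF b b' that] tables[of p q l] pq that unfolding P.table_def P'.table_def by blast
    then have "b (x p) (x q) \<otimes>\<^bsub>G\<^esub> b' (x p) (x q) = \<one>\<^bsub>G\<^esub>"
      using b(1) b'(1) by (intro P.eq_one_if_no_mark) auto
    then have "b (x p) (x q) \<otimes>\<^bsub>G\<^esub> b' (x p) (x q) = b' (x p) (x q) \<otimes>\<^bsub>G\<^esub> b' (x p) (x q)"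
      using b'(2) by simp
    then show ?thesis using b(1) b'(1) by simp
  qed
  note extend = P.homs_agree_on_generators[OF _ _ P.basis_closed P.generates]
  have "b u (x q) = b' u (x q)" if q: "q \<in> I" for q
    using basis[OF _ q] by (intro extend[OF P.hom_left P'.hom_left _ u] P.x_closed q) auto
  then show ?thesis
    by (intro extend[OF P.hom_right P'.hom_right _ v] u) auto
qed

text \<open>
  For a wide table the products are zero or have the unique nonzero table, and zero is recognized by
  \<open>trivial_iff\<close>. For a narrow table the entry \<open>(a,a)\<close> is present exactly when \<open>b\<close> is not alternating, and the entry
  \<open>(a,a2)\<close> exactly when \<open>diagonal_detects\<close> fails.
\<close>

lemma (in comm_group) invariant_product_unique:
  assumes fg: "finite S" "S \<subseteq> carrier G" "generate G S = carrier G"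
    and b: "invariant_product G b" and b': "invariant_product G b'"
    and alt: "invariant_product.alternating G b \<longleftrightarrow> invariant_product.alternating G b'"
    and det: "invariant_product.diagonal_detects G b \<longleftrightarrow> invariant_product.diagonal_detects G b'"
    and u: "u \<in> carrier G" and v: "v \<in> carrier G"
  shows "b u v = b' u v"
proof -
  obtain I :: "nat set" and x d where basis: "cyclic_basis G I x d"
    using ex_cyclic_basis[OF fg] by blast
  have loc: "cyclic_basis_product G I x d b" "cyclic_basis_product G I x d b'"
    using basis b b' by (simp_all add: cyclic_basis_product_def)
  interpret P: cyclic_basis_product G I x d b by (rule loc(1))
  interpret P': cyclic_basis_product G I x d b' by (rule loc(2))
  let ?C = "finite_top I d"
  have "P.table p q l \<longleftrightarrow> P'.table p q l" for p q l
  proof (cases "P.alternating \<and> P.diagonal_detects")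
    case True
    then have triv: "\<forall>u\<in>carrier G. \<forall>v\<in>carrier G. b u v = \<one>" "\<forall>u\<in>carrier G. \<forall>v\<in>carrier G. b' u v = \<one>"
      unfolding P.trivial_iff P'.trivial_iff using alt det by simp_all
    have "\<not> P.table p q l"
    proof
      assume *: "P.table p q l"
      then have pq: "p \<in> I" "q \<in> I" using P.supported[OF *] by simp_all
      then show False using * triv(1) P.x_closed P.value_eq_one[OF pq] by simp
    qed
    moreover have "\<not> P'.table p q l"
    proof
      assume *: "P'.table p q l"
      then have pq: "p \<in> I" "q \<in> I" using P'.supported[OF *] by simp_all
      then show False using * triv(2) P.x_closed P'.value_eq_one[OF pq] by simp
    qed
    ultimately show ?thesis by simp
  next
    case False
    have nontrivial: "\<exists>p q l. P.table p q l"
    proof (rule ccontr)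
      assume "\<not> ?thesis"
      then have "\<forall>u\<in>carrier G. \<forall>v\<in>carrier G. b u v = \<one>"
        using P.trivial_if_table_empty by blast
      then show False using False P.trivial_iff by simp
    qed
    have nontrivial': "\<exists>p q l. P'.table p q l"
    proof (rule ccontr)
      assume "\<not> ?thesis"
      then have "\<forall>u\<in>carrier G. \<forall>v\<in>carrier G. b' u v = \<one>"
        using P'.trivial_if_table_empty by blast
      then show False using False alt det P'.trivial_iff by simp
    qed
    obtain p0 q0 k0 where entry: "P.table p0 q0 k0" using nontrivial by blast
    obtain p1 q1 k1 where entry': "P'.table p1 q1 k1" using nontrivial' by blast
    from entry have "I \<noteq> {}" using P.supported[of p0 q0 k0] by auto
    obtain a where a: "a \<in> I" "\<And>j. j \<in> I \<Longrightarrow> dominates d a j"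
      using ex_dominating[OF P.finite_I \<open>I \<noteq> {}\<close>] by blast
    show ?thesis
    proof (cases "\<exists>l1\<in>?C. \<exists>l2\<in>?C. l1 \<noteq> l2")
      case True
      then obtain l1 l2 where l: "l1 \<in> ?C" "l2 \<in> ?C" "l1 \<noteq> l2" by blast
      show ?thesis
      proof (cases "d a = 0")
        case True
        show ?thesis
          using P.wide_table_infinite[OF l a True, of p0 q0 k0] P.wide_table_infinite[OF l a True, of p q l]
            P'.wide_table_infinite[OF l a True, of p1 q1 k1] P'.wide_table_infinite[OF l a True, of p q l]
            entry entry' by simp
      next
        case False
        show ?thesis
          using P.wide_table_finite[OF l a False, of p0 q0 k0] P.wide_table_finite[OF l a False, of p q l]
            P'.wide_table_finite[OF l a False, of p1 q1 k1] P'.wide_table_finite[OF l a False, of p q l]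
            entry entry' by simp
      qed
    next
      case False
      then have narrow: "l = l'" if "l \<in> ?C" "l' \<in> ?C" for l l'
        using that by blast
      obtain a2 where a2: "a2 \<noteq> a" "\<And>j. j \<in> I \<Longrightarrow> j \<noteq> a \<Longrightarrow> a2 \<in> I \<and> dominates d a2 j"
      proof (cases "I - {a} = {}")
        \<comment> \<open>for a cyclic group any index outside the basis serves as the second one\<close>
        case True
        then show ?thesis using that[of "Suc a"] by auto
      next
        case False
        then obtain a2 where "a2 \<in> I - {a}" "\<forall>j\<in>I - {a}. dominates d a2 j"
          using ex_dominating[of "I - {a}" d] P.finite_I by blast
        then show ?thesis using that[of a2] by blast
      qed
      have entries: "p = a \<and> q = a \<or> p = a \<and> q = a2 \<or> p = a2 \<and> q = a" if "P.table p q l" for p q l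
        by (rule P.narrow_table[OF narrow a a2 that])
      have entries': "p = a \<and> q = a \<or> p = a \<and> q = a2 \<or> p = a2 \<and> q = a" if "P'.table p q l" for p q l
        by (rule P'.narrow_table[OF narrow a a2 that])
      have "P.diagonal_detects \<longleftrightarrow> (\<forall>l. \<not> P.table a a2 l)"
        by (rule P.diagonal_detects_iff[OF entries a2(1)])
      moreover have "P'.diagonal_detects \<longleftrightarrow> (\<forall>l. \<not> P'.table a a2 l)"
        by (rule P'.diagonal_detects_iff[OF entries' a2(1)])
      ultimately have off: "(\<exists>l. P.table a a2 l) \<longleftrightarrow> (\<exists>l. P'.table a a2 l)"
        using det by blast
      have "p = a" if "P.table p p l" for p l
        using entries[OF that] by auto
      then have "P.alternating \<longleftrightarrow> (\<forall>l. \<not> P.table a a l)"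
        unfolding P.alternating_iff by blast
      moreover have "p = a" if "P'.table p p l" for p l
        using entries'[OF that] by auto
      then have "P'.alternating \<longleftrightarrow> (\<forall>l. \<not> P'.table a a l)"
        unfolding P'.alternating_iff by blast
      ultimately have diag: "(\<exists>l. P.table a a l) \<longleftrightarrow> (\<exists>l. P'.table a a l)"
        using alt by blast
      have same: "P.table p q l \<longleftrightarrow> P'.table p q l"
        if iff: "(\<exists>l. P.table p q l) \<longleftrightarrow> (\<exists>l. P'.table p q l)" for p q l
      proof
        assume *: "P.table p q l"
        then obtain l' where l': "P'.table p q l'" using iff by blast
        have "l = l'" by (rule narrow[OF P.value_in_finite_top[OF *] P'.value_in_finite_top[OF l']])
        then show "P'.table p q l" using l' by simp
      next
        assume *: "P'.table p q l"
        then obtain l' where l': "P.table p q l'" using iff by blast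
        have "l = l'" by (rule narrow[OF P'.value_in_finite_top[OF *] P.value_in_finite_top[OF l']])
        then show "P.table p q l" using l' by simp
      qed
      show ?thesis
      proof (cases "p = a \<and> q = a \<or> p = a \<and> q = a2 \<or> p = a2 \<and> q = a")
        case True
        then show ?thesis
          using same[OF diag, of l] same[OF off, of l] P.sym[of p q l] P'.sym[of p q l] by auto
      next
        case False
        then show ?thesis using entries[of p q l] entries'[of p q l] by argo
      qed
    qed
  qed
  then show ?thesis
    by (intro product_determined_by_table[OF loc _ u v])
qed

section \<open>The normalizer of the holomorph\<close>

lemma perm_apply_closed: "f \<in> carrier (BijGroup A) \<Longrightarrow> x \<in> A \<Longrightarrow> f x \<in> A"
  unfolding BijGroup_def using Bij_imp_funcset by fastforce

lemma perm_mult: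
  "f \<in> carrier (BijGroup A) \<Longrightarrow> g \<in> carrier (BijGroup A) \<Longrightarrow> x \<in> A \<Longrightarrow> (f \<otimes>\<^bsub>BijGroup A\<^esub> g) x = f (g x)"
  unfolding BijGroup_def by (simp add: compose_eq)

lemma perm_inv_apply:
  assumes "f \<in> carrier (BijGroup A)" "x \<in> A"
  shows "(inv\<^bsub>BijGroup A\<^esub> f) (f x) = x" "f ((inv\<^bsub>BijGroup A\<^esub> f) x) = x"
proof -
  have f: "f \<in> Bij A" using assms(1) unfolding BijGroup_def by simp
  then have bij: "bij_betw f A A" unfolding Bij_def by blast
  have "f x \<in> A" using perm_apply_closed[OF assms] .
  then show "(inv\<^bsub>BijGroup A\<^esub> f) (f x) = x"
    using inv_BijGroup[OF f] assms(2) bij_betw_inv_into_left[OF bij assms(2)] by simp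
  show "f ((inv\<^bsub>BijGroup A\<^esub> f) x) = x"
    using inv_BijGroup[OF f] assms(2) bij_betw_inv_into_right[OF bij assms(2)] by simp
qed

lemma perm_extensional: "f \<in> carrier (BijGroup A) \<Longrightarrow> f \<in> extensional A"
  unfolding BijGroup_def by (simp add: Bij_imp_extensional)

lemma perm_ext:
  assumes "f \<in> carrier (BijGroup A)" "g \<in> carrier (BijGroup A)" "\<And>x. x \<in> A \<Longrightarrow> f x = g x"
  shows "f = g"
proof (rule extensionalityI[of _ A])
  show "f \<in> extensional A" "g \<in> extensional A"
    by (rule perm_extensional, fact)+
qed (rule assms(3))

lemma perm_restrict:
  assumes "bij_betw f A A"
  shows "restrict f A \<in> carrier (BijGroup A)"
  using assms unfolding BijGroup_def Bij_def by (simp add: bij_betw_restrict_eq)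

lemma (in group) mem_normalizer_iff:
  assumes "H \<subseteq> carrier G"
  shows "a \<in> normalizer G H \<longleftrightarrow> a \<in> carrier G \<and> (\<lambda>h. a \<otimes> h \<otimes> inv a) ` H = H"
proof -
  have "a <# H #> inv a = (\<lambda>h. a \<otimes> h \<otimes> inv a) ` H"
    unfolding l_coset_def r_coset_def by auto
  then show ?thesis
    using assms unfolding normalizer_def stabilizer_def by simp
qed

context comm_group
begin

abbreviation perms :: "('a \<Rightarrow> 'a) monoid"
  where "perms \<equiv> BijGroup (carrier G)"

interpretation perms: group perms
  by (rule group_BijGroup)

lemma regular_rep_perm:
  assumes "g \<in> carrier G"
  shows "regular_rep G g \<in> carrier perms"
  unfolding regular_rep_def
proof (rule perm_restrict)
  show "bij_betw (\<lambda>x. x \<otimes> g) (carrier G) (carrier G)"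
    by (rule bij_betw_byWitness[where f' = "\<lambda>x. x \<otimes> inv g"]) (use assms in \<open>auto simp: m_assoc\<close>)
qed

lemma regular_rep_subset: "regular_rep G ` carrier G \<subseteq> carrier perms"
  using regular_rep_perm by blast

lemma regular_rep_apply: "x \<in> carrier G \<Longrightarrow> regular_rep G g x = x \<otimes> g"
  unfolding regular_rep_def by simp

lemma Hol_subgroup: "subgroup (Hol G) perms"
  unfolding Hol_def by (rule perms.normalizer_imp_subgroup[OF regular_rep_subset])

lemma NHol_subgroup: "subgroup (NHol G) perms"
  unfolding NHol_def by (rule perms.normalizer_imp_subgroup[OF subgroup.subset[OF Hol_subgroup]])

lemma Hol_normal: "Hol G \<lhd> perms\<lparr>carrier := NHol G\<rparr>"
  unfolding NHol_def by (rule perms.subgroup_in_normalizer[OF Hol_subgroup])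

lemma Hol_perm: "h \<in> Hol G \<Longrightarrow> h \<in> carrier perms"
  using subgroup.mem_carrier[OF Hol_subgroup] .

lemma NHol_perm: "h \<in> NHol G \<Longrightarrow> h \<in> carrier perms"
  using subgroup.mem_carrier[OF NHol_subgroup] .

text \<open>
  Conjugating a translation by \<open>h\<close> gives a translation, say by \<open>k\<close>, that is, \<open>h (v \<otimes> g) = h v \<otimes> k\<close> for all \<open>v\<close>.
  Take \<open>v = u\<close> and \<open>v = \<one>\<close>, and eliminate \<open>k\<close>.
\<close>

lemma Hol_affine:
  assumes h: "h \<in> Hol G" and u: "u \<in> carrier G" and g: "g \<in> carrier G"
  shows "h (u \<otimes> g) \<otimes> h \<one> = h u \<otimes> h g"
proof -
  have hp: "h \<in> carrier perms" by (rule Hol_perm[OF h])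
  have "h \<otimes>\<^bsub>perms\<^esub> regular_rep G g \<otimes>\<^bsub>perms\<^esub> inv\<^bsub>perms\<^esub> h \<in> regular_rep G ` carrier G"
    using h g perms.mem_normalizer_iff[OF regular_rep_subset, of h] unfolding Hol_def by blast
  then obtain k where k: "k \<in> carrier G"
    and eq: "h \<otimes>\<^bsub>perms\<^esub> regular_rep G g \<otimes>\<^bsub>perms\<^esub> inv\<^bsub>perms\<^esub> h = regular_rep G k" by blast
  have shift: "h (v \<otimes> g) = h v \<otimes> k" if v: "v \<in> carrier G" for v
  proof -
    have hv: "h v \<in> carrier G" using perm_apply_closed[OF hp v] .
    have "(h \<otimes>\<^bsub>perms\<^esub> regular_rep G g \<otimes>\<^bsub>perms\<^esub> inv\<^bsub>perms\<^esub> h) (h v) = h (v \<otimes> g)"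
      using hp hv v regular_rep_perm[OF g] perm_inv_apply[OF hp v] regular_rep_apply[OF v]
      by (simp add: perm_mult)
    then show ?thesis unfolding eq regular_rep_apply[OF hv] by simp
  qed
  have c: "h u \<in> carrier G" "h \<one> \<in> carrier G" using perm_apply_closed[OF hp] u by auto
  have "h g = h \<one> \<otimes> k" using shift[OF one_closed] g by simp
  then show ?thesis using shift[OF u] c k by (simp add: m_ac)
qed

lemma HolI:
  assumes hp: "h \<in> carrier perms"
    and affine: "\<And>u g. u \<in> carrier G \<Longrightarrow> g \<in> carrier G \<Longrightarrow> h (u \<otimes> g) \<otimes> h \<one> = h u \<otimes> h g"
  shows "h \<in> Hol G"
proof -
  note cl = perm_apply_closed[OF hp]
  have conj: "h \<otimes>\<^bsub>perms\<^esub> regular_rep G g \<otimes>\<^bsub>perms\<^esub> inv\<^bsub>perms\<^esub> h = regular_rep G (h g \<otimes> inv (h \<one>))"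
    if g: "g \<in> carrier G" for g
  proof (rule perm_ext[of _ "carrier G"])
    fix y assume y: "y \<in> carrier G"
    let ?u = "(inv\<^bsub>perms\<^esub> h) y"
    have u: "?u \<in> carrier G" using perm_apply_closed[OF perms.inv_closed[OF hp] y] .
    have "(h \<otimes>\<^bsub>perms\<^esub> regular_rep G g \<otimes>\<^bsub>perms\<^esub> inv\<^bsub>perms\<^esub> h) y = h (?u \<otimes> g)"
      using hp y u regular_rep_perm[OF g] regular_rep_apply[OF u] by (simp add: perm_mult)
    also have "\<dots> = h (?u \<otimes> g) \<otimes> h \<one> \<otimes> inv (h \<one>)"
      using cl u g by (simp add: m_assoc)
    also have "\<dots> = y \<otimes> (h g \<otimes> inv (h \<one>))"
      using affine[OF u g] perm_inv_apply(2)[OF hp y] cl g y by (simp add: m_assoc)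
    finally show "(h \<otimes>\<^bsub>perms\<^esub> regular_rep G g \<otimes>\<^bsub>perms\<^esub> inv\<^bsub>perms\<^esub> h) y = regular_rep G (h g \<otimes> inv (h \<one>)) y"
      using regular_rep_apply[OF y] by simp
  qed (use hp regular_rep_perm g cl in auto)
  have "(\<lambda>f. h \<otimes>\<^bsub>perms\<^esub> f \<otimes>\<^bsub>perms\<^esub> inv\<^bsub>perms\<^esub> h) ` regular_rep G ` carrier G = regular_rep G ` carrier G"
  proof (intro equalityI subsetI)
    fix f assume "f \<in> (\<lambda>f. h \<otimes>\<^bsub>perms\<^esub> f \<otimes>\<^bsub>perms\<^esub> inv\<^bsub>perms\<^esub> h) ` regular_rep G ` carrier G"
    then obtain g where g: "g \<in> carrier G" "f = h \<otimes>\<^bsub>perms\<^esub> regular_rep G g \<otimes>\<^bsub>perms\<^esub> inv\<^bsub>perms\<^esub> h"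
      by blast
    then show "f \<in> regular_rep G ` carrier G" using conj[OF g(1)] cl by simp
  next
    fix f assume "f \<in> regular_rep G ` carrier G"
    then obtain k where k: "k \<in> carrier G" "f = regular_rep G k" by blast
    define g where "g = (inv\<^bsub>perms\<^esub> h) (k \<otimes> h \<one>)"
    have kh: "k \<otimes> h \<one> \<in> carrier G" using k cl by simp
    have g: "g \<in> carrier G" "h g = k \<otimes> h \<one>"
      unfolding g_def using perm_apply_closed[OF perms.inv_closed[OF hp] kh] perm_inv_apply(2)[OF hp kh] by auto
    then have "f = h \<otimes>\<^bsub>perms\<^esub> regular_rep G g \<otimes>\<^bsub>perms\<^esub> inv\<^bsub>perms\<^esub> h"
      using conj[OF g(1)] k cl by (simp add: m_assoc)
    then show "f \<in> (\<lambda>f. h \<otimes>\<^bsub>perms\<^esub> f \<otimes>\<^bsub>perms\<^esub> inv\<^bsub>perms\<^esub> h) ` regular_rep G ` carrier G"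
      using g(1) by blast
  qed
  then show ?thesis
    unfolding Hol_def using perms.mem_normalizer_iff[OF regular_rep_subset, of h] hp by blast
qed

lemma iso_in_Hol:
  assumes "\<phi> \<in> iso G G"
  shows "restrict \<phi> (carrier G) \<in> Hol G"
proof (rule HolI)
  have hom: "\<phi> \<in> hom G G" and bij: "bij_betw \<phi> (carrier G) (carrier G)"
    using assms unfolding iso_def by auto
  show "restrict \<phi> (carrier G) \<in> carrier perms" by (rule perm_restrict[OF bij])
  fix u g assume "u \<in> carrier G" "g \<in> carrier G"
  then show "restrict \<phi> (carrier G) (u \<otimes> g) \<otimes> restrict \<phi> (carrier G) \<one>
      = restrict \<phi> (carrier G) u \<otimes> restrict \<phi> (carrier G) g"
    using hom_mult[OF hom] hom_one[OF hom is_group is_group] hom_in_carrier[OF hom] by simp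
qed

lemma regular_rep_in_Hol: "g \<in> carrier G \<Longrightarrow> regular_rep G g \<in> Hol G"
  by (rule HolI[OF regular_rep_perm]) (auto simp: regular_rep_apply m_ac)

lemma Hol_fixing_one_iso:
  assumes h: "h \<in> Hol G" and one: "h \<one> = \<one>"
  shows "h \<in> iso G G"
proof (rule isoI)
  show "h \<in> hom G G"
    using Hol_affine[OF h] one perm_apply_closed[OF Hol_perm[OF h]] by (intro homI) simp_all
  show "bij_betw h (carrier G) (carrier G)"
    using Hol_perm[OF h] unfolding BijGroup_def Bij_def by simp
qed

lemma NHol_conj:
  assumes "\<theta> \<in> NHol G" "h \<in> Hol G"
  shows "\<theta> \<otimes>\<^bsub>perms\<^esub> h \<otimes>\<^bsub>perms\<^esub> inv\<^bsub>perms\<^esub> \<theta> \<in> Hol G"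
  using assms perms.mem_normalizer_iff[OF subgroup.subset[OF Hol_subgroup], of \<theta>] unfolding NHol_def by blast

text \<open>
  The group operation on the set \<open>G\<close> that makes \<open>\<theta>\<close> an isomorphism from \<open>G\<close>.
\<close>

definition transported :: "('a \<Rightarrow> 'a) \<Rightarrow> 'a \<Rightarrow> 'a \<Rightarrow> 'a"
  where "transported \<theta> u v = \<theta> ((inv\<^bsub>perms\<^esub> \<theta>) u \<otimes> (inv\<^bsub>perms\<^esub> \<theta>) v)"

definition deviation :: "('a \<Rightarrow> 'a) \<Rightarrow> 'a \<Rightarrow> 'a \<Rightarrow> 'a"
  where "deviation \<theta> u v = transported \<theta> u v \<otimes> inv (u \<otimes> v)"

end

text \<open>
  These permutations represent all classes of \<open>T_group G\<close>: composing a member of \<open>NHol G\<close> with a translation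
  makes it fix \<open>\<one>\<close>.
\<close>

locale fixing_NHol = comm_group G for G (structure) +
  fixes \<theta>
  assumes \<theta>: "\<theta> \<in> NHol G" and \<theta>_one: "\<theta> \<one> = \<one>"
begin

interpretation perms: group perms
  by (rule group_BijGroup)

abbreviation \<tau> :: "'a \<Rightarrow> 'a"
  where "\<tau> \<equiv> inv\<^bsub>perms\<^esub> \<theta>"

lemma \<theta>_perm: "\<theta> \<in> carrier perms"
  using NHol_perm[OF \<theta>] .

lemma \<tau>_perm: "\<tau> \<in> carrier perms"
  using \<theta>_perm by simp

lemma \<tau>_NHol: "\<tau> \<in> NHol G"
  using subgroup.m_inv_closed[OF NHol_subgroup \<theta>] .

lemma \<theta>_closed [simp]: "u \<in> carrier G \<Longrightarrow> \<theta> u \<in> carrier G"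
  using perm_apply_closed[OF \<theta>_perm] .

lemma \<tau>_closed [simp]: "u \<in> carrier G \<Longrightarrow> \<tau> u \<in> carrier G"
  using perm_apply_closed[OF \<tau>_perm] .

lemma \<tau>_\<theta> [simp]: "u \<in> carrier G \<Longrightarrow> \<tau> (\<theta> u) = u" and \<theta>_\<tau> [simp]: "u \<in> carrier G \<Longrightarrow> \<theta> (\<tau> u) = u"
  by (rule perm_inv_apply[OF \<theta>_perm]; assumption)+

lemma \<tau>_one: "\<tau> \<one> = \<one>"
  using \<tau>_\<theta>[of \<one>] \<theta>_one by simp

lemma \<theta>_eq_one: "u \<in> carrier G \<Longrightarrow> \<theta> u = \<one> \<longleftrightarrow> u = \<one>"
  using \<theta>_one \<tau>_one \<tau>_\<theta> by metis

lemma inverse: "fixing_NHol G \<tau>"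
  by unfold_locales (rule \<tau>_NHol \<tau>_one)+

lemma transported_closed: "u \<in> carrier G \<Longrightarrow> v \<in> carrier G \<Longrightarrow> transported \<theta> u v \<in> carrier G"
  unfolding transported_def by simp

lemma transported_one: "v \<in> carrier G \<Longrightarrow> transported \<theta> \<one> v = v"
  unfolding transported_def using \<tau>_one by simp

lemma transported_commute: "u \<in> carrier G \<Longrightarrow> v \<in> carrier G \<Longrightarrow> transported \<theta> u v = transported \<theta> v u"
  unfolding transported_def by (simp add: m_comm)

lemma transported_assoc:
  "u \<in> carrier G \<Longrightarrow> v \<in> carrier G \<Longrightarrow> w \<in> carrier G \<Longrightarrow>
    transported \<theta> (transported \<theta> u v) w = transported \<theta> u (transported \<theta> v w)"
  unfolding transported_def by (simp add: m_assoc)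

lemma transported_translation:
  assumes "v \<in> carrier G"
  shows "(\<lambda>u\<in>carrier G. transported \<theta> u v) \<in> Hol G"
proof -
  have v: "\<tau> v \<in> carrier G" using assms by simp
  let ?h = "\<theta> \<otimes>\<^bsub>perms\<^esub> regular_rep G (\<tau> v) \<otimes>\<^bsub>perms\<^esub> \<tau>"
  have h: "?h \<in> Hol G" by (rule NHol_conj[OF \<theta> regular_rep_in_Hol[OF v]])
  have at: "?h u = transported \<theta> u v" if "u \<in> carrier G" for u
    using that \<theta>_perm \<tau>_perm regular_rep_perm[OF v]
    by (simp add: perm_mult regular_rep_apply transported_def)
  have "?h \<in> extensional (carrier G)"
    by (rule perm_extensional[OF Hol_perm[OF h]])
  then have "?h = (\<lambda>u\<in>carrier G. transported \<theta> u v)"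
    by (rule extensionalityI) (simp_all add: at)
  then show ?thesis using h by simp
qed

lemma transported_mult:
  assumes "u \<in> carrier G" "v \<in> carrier G" "w \<in> carrier G"
  shows "transported \<theta> (u \<otimes> v) w \<otimes> w = transported \<theta> u w \<otimes> transported \<theta> v w"
  using Hol_affine[OF transported_translation[OF assms(3)] assms(1,2)] assms transported_one by simp

text \<open>
  The conjugate of \<open>\<phi>\<close> by \<open>\<tau>\<close> is again in \<open>Hol G\<close> and fixes \<open>\<one>\<close>, so it is an automorphism of \<open>G\<close>; hence \<open>\<phi>\<close>
  is an automorphism of the transported group.
\<close>

lemma transported_iso:
  assumes \<phi>: "\<phi> \<in> iso G G" and u: "u \<in> carrier G" and v: "v \<in> carrier G"
  shows "\<phi> (transported \<theta> u v) = transported \<theta> (\<phi> u) (\<phi> v)"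
proof -
  let ?\<phi> = "restrict \<phi> (carrier G)"
  let ?\<psi> = "\<tau> \<otimes>\<^bsub>perms\<^esub> ?\<phi> \<otimes>\<^bsub>perms\<^esub> \<theta>"
  have hom: "\<phi> \<in> hom G G" using \<phi> unfolding iso_def by simp
  note cl = hom_in_carrier[OF hom]
  have "?\<psi> \<in> Hol G"
    using NHol_conj[OF \<tau>_NHol iso_in_Hol[OF \<phi>]] \<theta>_perm by simp
  have \<psi>: "?\<psi> w = \<tau> (\<phi> (\<theta> w))" if "w \<in> carrier G" for w
    using that \<theta>_perm \<tau>_perm Hol_perm[OF iso_in_Hol[OF \<phi>]] by (simp add: perm_mult)
  then have "?\<psi> \<one> = \<one>"
    using \<theta>_one \<tau>_one hom_one[OF hom is_group is_group] by simp
  then have \<psi>_hom: "?\<psi> \<in> hom G G"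
    using Hol_fixing_one_iso[OF \<open>?\<psi> \<in> Hol G\<close>] unfolding iso_def by simp
  have "?\<psi> (\<tau> u \<otimes> \<tau> v) = ?\<psi> (\<tau> u) \<otimes> ?\<psi> (\<tau> v)"
    by (rule hom_mult[OF \<psi>_hom \<tau>_closed[OF u] \<tau>_closed[OF v]])
  then have "\<tau> (\<phi> (\<theta> (\<tau> u \<otimes> \<tau> v))) = \<tau> (\<phi> u) \<otimes> \<tau> (\<phi> v)"
    using \<psi> u v by simp
  then have "\<theta> (\<tau> (\<phi> (\<theta> (\<tau> u \<otimes> \<tau> v)))) = \<theta> (\<tau> (\<phi> u) \<otimes> \<tau> (\<phi> v))" by simp
  then show ?thesis unfolding transported_def using u v cl by simp
qed

lemma transported_eq:
  assumes "u \<in> carrier G" "v \<in> carrier G"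
  shows "transported \<theta> u v = u \<otimes> v \<otimes> deviation \<theta> u v"
proof -
  have "p \<otimes> (t \<otimes> inv p) = t" if "p \<in> carrier G" "t \<in> carrier G" for p t
    using that m_lcomm[of p t "inv p"] by simp
  then show ?thesis
    unfolding deviation_def using assms transported_closed[OF assms] by simp
qed

sublocale product: invariant_product G "deviation \<theta>"
proof
  fix u v assume uv: "u \<in> carrier G" "v \<in> carrier G"
  show "deviation \<theta> u v \<in> carrier G"
    unfolding deviation_def using uv transported_closed by simp
  show "deviation \<theta> u v = deviation \<theta> v u"
    unfolding deviation_def using transported_commute[OF uv] m_comm[OF uv] by simp
  show "deviation \<theta> (u \<otimes> v) w = deviation \<theta> u w \<otimes> deviation \<theta> v w" if w: "w \<in> carrier G" for w
  proof -
    note c = transported_closed[OF uv(1) w] transported_closed[OF uv(2) w] transported_closed[OF m_closed[OF uv] w]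
    have "transported \<theta> (u \<otimes> v) w = transported \<theta> u w \<otimes> transported \<theta> v w \<otimes> inv w"
      using transported_mult[OF uv w] c w by (metis inv_solve_right m_closed)
    then show ?thesis
      unfolding deviation_def using c uv w by (simp add: m_ac inv_mult)
  qed
  show "\<phi> (deviation \<theta> u v) = deviation \<theta> (\<phi> u) (\<phi> v)" if \<phi>: "\<phi> \<in> iso G G" for \<phi>
  proof -
    interpret \<phi>: group_hom G G \<phi>
      using \<phi> by unfold_locales (simp add: iso_def)
    show ?thesis
      unfolding deviation_def using uv transported_closed transported_iso[OF \<phi> uv] by simp
  qed
qed

text \<open>
  This is associativity of the transported operation, with the common terms cancelled.
\<close>

lemma deviation_assoc:
  assumes u: "u \<in> carrier G" and v: "v \<in> carrier G" and w: "w \<in> carrier G"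
  shows "deviation \<theta> (deviation \<theta> u v) w = deviation \<theta> u (deviation \<theta> v w)"
proof -
  let ?b = "deviation \<theta>"
  note c = product.closed
  note cc = c[OF u v] c[OF u w] c[OF v w] c[OF c[OF u v] w] c[OF u c[OF v w]]
  let ?r = "u \<otimes> v \<otimes> w \<otimes> ?b u v \<otimes> ?b u w \<otimes> ?b v w"
  have "transported \<theta> (transported \<theta> u v) w = u \<otimes> v \<otimes> ?b u v \<otimes> w \<otimes> (?b u w \<otimes> ?b v w \<otimes> ?b (?b u v) w)"
    using u v w cc by (simp add: transported_eq product.mult_left)
  also have "\<dots> = ?r \<otimes> ?b (?b u v) w"
    using u v w cc by (simp add: m_ac)
  finally have left: "transported \<theta> (transported \<theta> u v) w = ?r \<otimes> ?b (?b u v) w" .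
  have "transported \<theta> u (transported \<theta> v w) = u \<otimes> (v \<otimes> w \<otimes> ?b v w) \<otimes> (?b u v \<otimes> ?b u w \<otimes> ?b u (?b v w))"
    using u v w cc by (simp add: transported_eq product.mult_right)
  also have "\<dots> = ?r \<otimes> ?b u (?b v w)"
    using u v w cc by (simp add: m_ac)
  finally have right: "transported \<theta> u (transported \<theta> v w) = ?r \<otimes> ?b u (?b v w)" .
  have "?r \<otimes> ?b (?b u v) w = ?r \<otimes> ?b u (?b v w)"
    using left right transported_assoc[OF u v w] by simp
  moreover have "?r \<in> carrier G" using u v w cc by simp
  ultimately show ?thesis using cc by simp
qed

text \<open>
  The map is a translation of the transported group followed by a translation of \<open>G\<close>. Both are in \<open>Hol G\<close> and the
  composite fixes \<open>\<one>\<close>.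
\<close>

lemma shear_iso:
  assumes u: "u \<in> carrier G"
  shows "(\<lambda>v\<in>carrier G. v \<otimes> deviation \<theta> v u) \<in> iso G G"
proof -
  let ?f = "\<lambda>v\<in>carrier G. v \<otimes> deviation \<theta> v u"
  let ?t = "\<lambda>v\<in>carrier G. transported \<theta> v u"
  let ?h = "regular_rep G (inv u) \<otimes>\<^bsub>perms\<^esub> ?t"
  have t: "?t \<in> Hol G" by (rule transported_translation[OF u])
  have h: "?h \<in> Hol G"
    using subgroup.m_closed[OF Hol_subgroup regular_rep_in_Hol t] u by simp
  have at: "?h v = v \<otimes> deviation \<theta> v u" if v: "v \<in> carrier G" for v
  proof -
    have "?h v = transported \<theta> v u \<otimes> inv u"
      using perm_mult[OF regular_rep_perm Hol_perm[OF t] v, of "inv u"] u v transported_closed[OF v u]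
      by (simp add: regular_rep_apply)
    also have "\<dots> = v \<otimes> deviation \<theta> v u"
      unfolding transported_eq[OF v u] using u v product.closed[OF v u] m_comm[of u "deviation \<theta> v u"]
      by (simp add: m_assoc)
    finally show ?thesis .
  qed
  have "?h = ?f"
    by (rule extensionalityI[OF perm_extensional[OF Hol_perm[OF h]]]) (simp_all add: at)
  moreover have "?f \<one> = \<one>"
    using product.one_left[OF u] by simp
  ultimately show ?thesis using Hol_fixing_one_iso[OF h] by simp
qed

text \<open>
  Apply the automorphism \<open>v \<mapsto> v + b(v,u)\<close> to \<open>b(v,w)\<close>. By associativity and commutativity every way of
  bracketing \<open>u, v, w\<close> gives the same \<open>z\<close>, and invariance becomes \<open>z = z + z + b(z,u) = b(z,u)\<close>. Hence the same
  automorphism sends \<open>z\<close> to \<open>z + z = 0\<close>, and \<open>z = 0\<close>.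
\<close>

lemma deviation_nilpotent:
  assumes u: "u \<in> carrier G" and v: "v \<in> carrier G" and w: "w \<in> carrier G"
  shows "deviation \<theta> (deviation \<theta> v w) u = \<one>"
proof -
  let ?b = "deviation \<theta>"
  let ?f = "\<lambda>v\<in>carrier G. v \<otimes> ?b v u"
  note c = product.closed
  have vw: "?b v w \<in> carrier G" and vu: "?b v u \<in> carrier G" and wu: "?b w u \<in> carrier G"
    using c u v w by auto
  define z where "z = ?b (?b v w) u"
  have z: "z \<in> carrier G" "z \<otimes> z = \<one>"
    unfolding z_def using c[OF vw u] product.involution[OF vw u] by auto
  have z1: "?b v (?b w u) = z"
    unfolding z_def by (rule deviation_assoc[OF v w u, symmetric])
  have "?b (?b v u) w = ?b v (?b w u)"
    using deviation_assoc[OF v u w] product.commute[OF u w] by simp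
  then have z2: "?b (?b v u) w = z" using z1 by simp
  have z3: "?b (?b v u) (?b w u) = ?b z u"
    using deviation_assoc[OF vu w u] z2 by simp
  have cancel: "z \<otimes> (z \<otimes> ?b z u) = ?b z u"
    using m_assoc[OF z(1) z(1) c[OF z(1) u]] z(2) c[OF z(1) u] by simp
  have "?f (?b v w) = ?b (?f v) (?f w)"
    by (rule product.invariant[OF shear_iso[OF u] v w])
  then have "?b v w \<otimes> z = ?b (v \<otimes> ?b v u) (w \<otimes> ?b w u)"
    using v w vw unfolding z_def by simp
  also have "\<dots> = (?b v w \<otimes> ?b (?b v u) w) \<otimes> (?b v (?b w u) \<otimes> ?b (?b v u) (?b w u))"
    using v w vu wu c by (simp add: product.mult_left product.mult_right)
  also have "\<dots> = ?b v w \<otimes> ?b z u"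
    unfolding z1 z2 z3 using vw z(1) c[OF z(1) u] cancel by (simp add: m_assoc)
  finally have "z = ?b z u"
    using z vw c[OF z(1) u] by simp
  then have "?f z = ?f \<one>"
    using z product.one_left[OF u] by simp
  moreover have "inj_on ?f (carrier G)"
    using shear_iso[OF u] unfolding iso_def bij_betw_def by blast
  ultimately have "z = \<one>" using z(1) by (simp only: inj_on_def) blast
  then show ?thesis unfolding z_def .
qed

text \<open>
  By \<open>deviation_nilpotent\<close> and \<open>2b = 0\<close>, the ordinary sum of \<open>\<theta> u\<close> and \<open>\<theta> v\<close> is their transported sum followed by
  transported addition of \<open>b(\<theta> u, \<theta> v)\<close>, and \<open>\<tau>\<close> turns transported sums into ordinary ones.
\<close>

lemma deviation_inverse:
  assumes u: "u \<in> carrier G" and v: "v \<in> carrier G"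
  shows "deviation \<tau> u v = \<tau> (deviation \<theta> (\<theta> u) (\<theta> v))"
proof -
  let ?z = "deviation \<theta> (\<theta> u) (\<theta> v)"
  let ?t = "transported \<theta> (\<theta> u) (\<theta> v)"
  have z: "?z \<in> carrier G" "?z \<otimes> ?z = \<one>"
    using product.closed product.involution u v by auto
  have t: "?t \<in> carrier G" using transported_closed u v by simp
  have "deviation \<theta> ?t ?z = deviation \<theta> ?z ?t"
    using product.commute t z by simp
  also have "\<dots> = \<one>" using deviation_nilpotent[OF t] u v by simp
  finally have "transported \<theta> ?t ?z = ?t \<otimes> ?z"
    using transported_eq[OF t z(1)] t z by simp
  also have "\<dots> = \<theta> u \<otimes> \<theta> v \<otimes> (?z \<otimes> ?z)"
    using transported_eq[of "\<theta> u" "\<theta> v"] u v z by (simp add: m_assoc)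
  finally have "\<theta> u \<otimes> \<theta> v = transported \<theta> ?t ?z"
    using z u v by simp
  also have "\<dots> = \<theta> (u \<otimes> v \<otimes> \<tau> ?z)"
    unfolding transported_def[of \<theta> ?t] using u v by (simp add: transported_def)
  finally have "\<tau> (\<theta> u \<otimes> \<theta> v) = u \<otimes> v \<otimes> \<tau> ?z"
    using u v z by simp
  moreover have "transported \<tau> u v = \<tau> (\<theta> u \<otimes> \<theta> v)"
    unfolding transported_def using \<theta>_perm by simp
  ultimately show ?thesis
    unfolding deviation_def[of \<tau>] using u v z m_comm[of "u \<otimes> v" "\<tau> ?z"] by (simp add: m_assoc)
qed

lemma deviation_inverse_trivial:
  assumes "u \<in> carrier G" "v \<in> carrier G"
  shows "deviation \<tau> (\<tau> u) (\<tau> v) = \<one> \<longleftrightarrow> deviation \<theta> u v = \<one>"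
proof -
  interpret inv: fixing_NHol G \<tau> by (rule inverse)
  show ?thesis
    using deviation_inverse[of "\<tau> u" "\<tau> v"] assms inv.\<theta>_eq_one[OF product.closed[OF assms]] by simp
qed

text \<open>
  The bijection \<open>\<tau>\<close> carries the pairs where the deviation of \<open>\<theta>\<close> is trivial to the pairs where the deviation of
  \<open>\<tau>\<close> is trivial, and both properties speak only of such pairs.
\<close>

lemma signature_inverse:
  "invariant_product.alternating G (deviation \<tau>) \<longleftrightarrow> product.alternating"
  "invariant_product.diagonal_detects G (deviation \<tau>) \<longleftrightarrow> product.diagonal_detects"
proof -
  interpret inv: fixing_NHol G \<tau> by (rule inverse)
  have range: "(\<forall>u\<in>carrier G. P u) \<longleftrightarrow> (\<forall>u\<in>carrier G. P (\<tau> u))" for P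
    using \<tau>_\<theta> \<theta>_closed \<tau>_closed by metis
  show "inv.product.alternating \<longleftrightarrow> product.alternating"
    unfolding inv.product.alternating_def product.alternating_def
    by (subst range) (simp add: deviation_inverse_trivial)
  have "inv.product.diagonal_detects \<longleftrightarrow>
    (\<forall>u\<in>carrier G. \<forall>v\<in>carrier G. deviation \<tau> (\<tau> u) (\<tau> u) = \<one> \<longrightarrow> deviation \<tau> (\<tau> u) (\<tau> v) = \<one>)"
    unfolding inv.product.diagonal_detects_def by (subst range, subst (2) range) simp
  then show "inv.product.diagonal_detects \<longleftrightarrow> product.diagonal_detects"
    unfolding product.diagonal_detects_def by (simp add: deviation_inverse_trivial)
qed

end

text \<open>
  Equal deviations mean equal transported operations, so \<open>\<tau>\<close> of \<open>\<phi>\<close> after \<open>\<theta>\<close> is an automorphism of \<open>G\<close>. The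
  quotient on the other side is its conjugate by \<open>\<phi>\<close>.
\<close>

lemma (in comm_group) quotient_in_Hol:
  assumes \<theta>: "fixing_NHol G \<theta>" and \<phi>: "fixing_NHol G \<phi>"
    and eq: "\<And>u v. u \<in> carrier G \<Longrightarrow> v \<in> carrier G \<Longrightarrow> deviation \<theta> u v = deviation \<phi> u v"
  shows "\<theta> \<otimes>\<^bsub>perms\<^esub> inv\<^bsub>perms\<^esub> \<phi> \<in> Hol G"
proof -
  interpret perms: group perms by (rule group_BijGroup)
  interpret \<theta>: fixing_NHol G \<theta> by (rule \<theta>)
  interpret \<phi>: fixing_NHol G \<phi> by (rule \<phi>)
  let ?\<psi> = "inv\<^bsub>perms\<^esub> \<phi> \<otimes>\<^bsub>perms\<^esub> \<theta>"
  have perm: "?\<psi> \<in> carrier perms" using \<theta>.\<theta>_perm \<phi>.\<tau>_perm by simp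
  have at: "?\<psi> u = \<phi>.\<tau> (\<theta> u)" if "u \<in> carrier G" for u
    using perm_mult[OF \<phi>.\<tau>_perm \<theta>.\<theta>_perm that] .
  have "?\<psi> \<in> Hol G"
  proof (rule HolI[OF perm])
    fix u g assume ug: "u \<in> carrier G" "g \<in> carrier G"
    have "\<theta> (u \<otimes> g) = transported \<theta> (\<theta> u) (\<theta> g)"
      unfolding transported_def using ug by simp
    also have "\<dots> = transported \<phi> (\<theta> u) (\<theta> g)"
      using \<theta>.transported_eq \<phi>.transported_eq eq ug by simp
    finally have "\<phi>.\<tau> (\<theta> (u \<otimes> g)) = \<phi>.\<tau> (\<theta> u) \<otimes> \<phi>.\<tau> (\<theta> g)"
      unfolding transported_def using ug by simp
    then show "?\<psi> (u \<otimes> g) \<otimes> ?\<psi> \<one> = ?\<psi> u \<otimes> ?\<psi> g"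
      using ug at \<theta>.\<theta>_one \<phi>.\<tau>_one by simp
  qed
  from NHol_conj[OF \<phi>.\<theta> this]
  show ?thesis
    using \<theta>.\<theta>_perm \<phi>.\<theta>_perm by (simp add: perms.m_assoc[symmetric])
qed

text \<open>
  Order three is excluded since an element with trivial square and trivial cube is trivial.
\<close>

lemma group_exponent_two_order_le_four:
  assumes "group Q" and square: "\<And>x. x \<in> carrier Q \<Longrightarrow> x \<otimes>\<^bsub>Q\<^esub> x = \<one>\<^bsub>Q\<^esub>"
    and fin: "finite (carrier Q)" and le: "card (carrier Q) \<le> 4"
  shows "elementary_abelian_2_group Q \<and> order Q \<in> {1, 2, 4}"
proof
  interpret group Q by fact
  have inv: "inv\<^bsub>Q\<^esub> x = x" if "x \<in> carrier Q" for x
    using inv_equality[OF square[OF that] that that] .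
  have "x \<otimes>\<^bsub>Q\<^esub> y = y \<otimes>\<^bsub>Q\<^esub> x" if xy: "x \<in> carrier Q" "y \<in> carrier Q" for x y
    using inv_mult_group[OF xy] inv[OF xy(1)] inv[OF xy(2)] inv[OF m_closed[OF xy]] by simp
  then have "comm_group Q" by (rule group_comm_groupI)
  then show "elementary_abelian_2_group Q"
    unfolding elementary_abelian_2_group_def using square by simp
  have "order Q \<noteq> 0" using order_gt_0_iff_finite fin by simp
  moreover have "order Q \<noteq> 3"
  proof
    assume three: "order Q = 3"
    have "x = \<one>\<^bsub>Q\<^esub>" if x: "x \<in> carrier Q" for x
    proof -
      have "x [^]\<^bsub>Q\<^esub> (3::nat) = \<one>\<^bsub>Q\<^esub>" using pow_order_eq_1[OF x] three by simp
      then show ?thesis using square[OF x] x by (simp add: numeral_3_eq_3)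
    qed
    then have "carrier Q = {\<one>\<^bsub>Q\<^esub>}" using one_closed by blast
    then show False using three unfolding order_def by simp
  qed
  ultimately show "order Q \<in> {1, 2, 4}"
    using le unfolding order_def by auto
qed

theorem theorem5p3:
  fixes G :: "('a, 'b) monoid_scheme"
  assumes "comm_group G"
    and "finitely_generated_group G"
  shows "elementary_abelian_2_group (T_group G) \<and> order (T_group G) \<in> {1, 2, 4}"
proof -
  interpret comm_group G by fact
  interpret perms: group perms by (rule group_BijGroup)
  obtain S where S: "finite S" "S \<subseteq> carrier G" "generate G S = carrier G"
    using assms(2) unfolding finitely_generated_group_def by blast
  let ?N = "perms\<lparr>carrier := NHol G\<rparr>"
  interpret N: group ?N
    by (rule perms.subgroup_imp_group[OF NHol_subgroup])
  interpret Hol: normal "Hol G" ?N by (rule Hol_normal)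
  have "\<exists>\<theta>. fixing_NHol G \<theta> \<and> C = Hol G #>\<^bsub>?N\<^esub> \<theta>" if C: "C \<in> rcosets\<^bsub>?N\<^esub> Hol G" for C
  proof -
    obtain \<theta> where \<theta>: "\<theta> \<in> NHol G" "C = Hol G #>\<^bsub>?N\<^esub> \<theta>"
      using C unfolding RCOSETS_def by auto
    note \<theta>_perm = NHol_perm[OF \<theta>(1)]
    have one: "\<theta> \<one>\<^bsub>G\<^esub> \<in> carrier G" using perm_apply_closed[OF \<theta>_perm] by simp
    \<comment> \<open>a translation moves the image of the neutral element back to it\<close>
    let ?r = "regular_rep G (inv\<^bsub>G\<^esub> (\<theta> \<one>\<^bsub>G\<^esub>))"
    have r: "?r \<in> Hol G" using regular_rep_in_Hol one by simp
    let ?\<phi> = "?r \<otimes>\<^bsub>perms\<^esub> \<theta>"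
    have mem: "?\<phi> \<in> Hol G #>\<^bsub>?N\<^esub> \<theta>"
      unfolding r_coset_def using r by auto
    have "C = Hol G #>\<^bsub>?N\<^esub> ?\<phi>"
      using N.repr_independence[OF mem _ Hol.subgroup_axioms] \<theta> by simp
    moreover have "?\<phi> \<one>\<^bsub>G\<^esub> = \<one>\<^bsub>G\<^esub>"
      using perm_mult[OF Hol_perm[OF r] \<theta>_perm one_closed] one by (simp add: regular_rep_apply)
    moreover have "?\<phi> \<in> NHol G"
      using subgroup.m_closed[OF NHol_subgroup _ \<theta>(1)] Hol.subset r by auto
    ultimately have "fixing_NHol G ?\<phi> \<and> C = Hol G #>\<^bsub>?N\<^esub> ?\<phi>"
      by (simp add: fixing_NHol_def fixing_NHol_axioms_def comm_group_axioms)
    then show ?thesis by blast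
  qed
  then have "\<forall>C\<in>rcosets\<^bsub>?N\<^esub> Hol G. \<exists>\<theta>. fixing_NHol G \<theta> \<and> C = Hol G #>\<^bsub>?N\<^esub> \<theta>"
    by blast
  from bchoice[OF this] obtain rep where
    rep: "fixing_NHol G (rep C) \<and> C = Hol G #>\<^bsub>?N\<^esub> rep C" if "C \<in> rcosets\<^bsub>?N\<^esub> Hol G" for C
    by blast
  have unique: "deviation \<theta> u v = deviation \<phi> u v"
    if "fixing_NHol G \<theta>" "fixing_NHol G \<phi>"
      "invariant_product.alternating G (deviation \<theta>) \<longleftrightarrow> invariant_product.alternating G (deviation \<phi>)"
      "invariant_product.diagonal_detects G (deviation \<theta>) \<longleftrightarrow> invariant_product.diagonal_detects G (deviation \<phi>)"
      "u \<in> carrier G" "v \<in> carrier G" for \<theta> \<phi> u v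
  proof -
    interpret \<theta>: fixing_NHol G \<theta> by fact
    interpret \<phi>: fixing_NHol G \<phi> by fact
    show ?thesis
      by (rule invariant_product_unique[OF S \<theta>.product.invariant_product_axioms
          \<phi>.product.invariant_product_axioms that(3-6)])
  qed
  let ?sig = "\<lambda>C. (invariant_product.alternating G (deviation (rep C)),
    invariant_product.diagonal_detects G (deviation (rep C)))"
  have inj: "inj_on ?sig (rcosets\<^bsub>?N\<^esub> Hol G)"
  proof (rule inj_onI)
    fix C D assume C: "C \<in> rcosets\<^bsub>?N\<^esub> Hol G" and D: "D \<in> rcosets\<^bsub>?N\<^esub> Hol G" and eq: "?sig C = ?sig D"
    interpret C: fixing_NHol G "rep C" using rep[OF C] by simp
    interpret D: fixing_NHol G "rep D" using rep[OF D] by simp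
    have "rep C \<otimes>\<^bsub>perms\<^esub> inv\<^bsub>perms\<^esub> rep D \<in> Hol G"
      using quotient_in_Hol[OF C.fixing_NHol_axioms D.fixing_NHol_axioms]
        unique[OF C.fixing_NHol_axioms D.fixing_NHol_axioms] eq by simp
    moreover have "rep C = rep C \<otimes>\<^bsub>perms\<^esub> inv\<^bsub>perms\<^esub> rep D \<otimes>\<^bsub>perms\<^esub> rep D"
      using C.\<theta>_perm D.\<theta>_perm by (simp add: perms.m_assoc)
    ultimately have "rep C \<in> Hol G #>\<^bsub>?N\<^esub> rep D"
      unfolding r_coset_def by auto
    then have "Hol G #>\<^bsub>?N\<^esub> rep D = Hol G #>\<^bsub>?N\<^esub> rep C"
      using N.repr_independence[OF _ _ Hol.subgroup_axioms] D.\<theta> by simp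
    then show "C = D" using rep[OF C] rep[OF D] by simp
  qed
  have T: "carrier (T_group G) = rcosets\<^bsub>?N\<^esub> Hol G"
    unfolding T_group_def FactGroup_def by simp
  have fin: "finite (carrier (T_group G))"
    unfolding T using finite_imageD[OF _ inj] by simp
  have "card (rcosets\<^bsub>?N\<^esub> Hol G) \<le> card (UNIV :: (bool \<times> bool) set)"
    by (rule card_inj_on_le[OF inj]) auto
  then have le: "card (carrier (T_group G)) \<le> 4"
    unfolding T by (simp add: card_UNIV_bool UNIV_Times_UNIV[symmetric] card_cartesian_product del: UNIV_Times_UNIV)
  have grp: "group (T_group G)"
    unfolding T_group_def by (rule Hol.factorgroup_is_group)
  have square: "C \<otimes>\<^bsub>T_group G\<^esub> C = \<one>\<^bsub>T_group G\<^esub>" if C: "C \<in> carrier (T_group G)" for C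
  proof -
    interpret C: fixing_NHol G "rep C" using rep C unfolding T by simp
    interpret inv: fixing_NHol G "inv\<^bsub>perms\<^esub> rep C" by (rule C.inverse)
    have "rep C \<otimes>\<^bsub>perms\<^esub> inv\<^bsub>perms\<^esub> (inv\<^bsub>perms\<^esub> rep C) \<in> Hol G"
      using quotient_in_Hol[OF C.fixing_NHol_axioms C.inverse]
        unique[OF C.fixing_NHol_axioms C.inverse] C.signature_inverse by simp
    then have "rep C \<otimes>\<^bsub>perms\<^esub> rep C \<in> Hol G" using C.\<theta>_perm by simp
    then have "Hol G #>\<^bsub>?N\<^esub> (rep C \<otimes>\<^bsub>?N\<^esub> rep C) = Hol G"
      using N.coset_join2[OF _ Hol.subgroup_axioms] Hol.subset by auto
    moreover have "C = Hol G #>\<^bsub>?N\<^esub> rep C" using rep C unfolding T by simp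
    ultimately have "C <#>\<^bsub>?N\<^esub> C = Hol G"
      using Hol.rcos_sum[of "rep C" "rep C"] C.\<theta> by simp
    then show ?thesis unfolding T_group_def FactGroup_def by simp
  qed
  show ?thesis
    by (rule group_exponent_two_order_le_four[OF grp square fin le])
qed

end
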